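(* Let $0<\alpha\le1$, let $D$ be a positive constant, and let $T$ be an integral operator $Tf(x)=\int_{\mathbb{R}^d}K_T(x,y)f(y)\,dy$, $f\in L^p(\mathbb{R}^d)$, whose kernel $K_T$ satisfies $$\Big\|\sup_{y\in\mathbb{R}^d}|K_T(y,\cdot+y)|\,\Big\|_{\mathcal{W}_1}\le D$$ and $$\Big\|\sup_{y\in\mathbb{R}^d}\omega_\delta(K_T)(y,\cdot+y)\Big\|_{\mathcal{W}_1}\le D\,\delta^\alpha\quad\text{for all }\delta\in(0,1).$$ Let $I$ be the identity operator. If $I+T$ has $L^p$-stability for some $1\le p\le\infty$, then it has $L^q$-stability for all $1\le q\le\infty$.
   Context: $L^p=L^p(\mathbb{R}^d)$ with standard norm $\|\cdot\|_p$. The Wiener amalgam norm on $\mathbb{R}^d$ is $\|\phi\|_{\mathcal{W}_1}=\sum_{k\in\mathbb{Z}^d}\sup_{x\in[0,1)^d}|\phi(k+x)|$. The modulus of continuity of a function $K$ on $\mathbb{R}^d\times\mathbb{R}^d$ is $\omega_\delta(K)(x,y)=\sup_{|(x',y')|\le\delta}|K(x+x',y+y')-K(x,y)|$, where $|\cdot|$ is the Euclidean norm on $\mathbb{R}^{2d}$. A bounded operator $S$ on $L^p$ has $L^p$-stability if there exists a positive constant $C$ such that $C^{-1}\|f\|_p\le\|Sf\|_p\le C\|f\|_p$ for all $f\in L^p$. *)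

theory Defs
  imports "HOL-Analysis.Analysis" "HOL-Probability.Essential_Supremum"
begin

text \<open>
  Functions are complex-valued, and elements of \<open>L\<^sup>p\<close> are represented by Borel
  functions: every almost-everywhere class of Lebesgue-measurable functions has a Borel
  representative, so \<open>lborel\<close> yields the usual spaces \<open>L\<^sup>p(\<real>\<^sup>d)\<close>. The exponent is an extended
  nonnegative real, so that \<open>p = \<infinity>\<close> is included; the definitions are meant for \<open>1 \<le> p\<close>.
\<close>

definition Lp_space :: "ennreal \<Rightarrow> (real^'d \<Rightarrow> complex) set" where
  "Lp_space p = {f \<in> borel_measurable lborel.
     if p = \<infinity> then esssup lborel (\<lambda>x. ereal (norm (f x))) < \<infinity>
     else integrable lborel (\<lambda>x. norm (f x) powr enn2real p)}"

definition Lp_norm :: "ennreal \<Rightarrow> (real^'d \<Rightarrow> complex) \<Rightarrow> real" where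
  "Lp_norm p f =
     (if p = \<infinity> then real_of_ereal (esssup lborel (\<lambda>x. ereal (norm (f x))))
      else (LINT x|lborel. norm (f x) powr enn2real p) powr (1 / enn2real p))"

text \<open>
  An operator on \<open>L\<^sup>p\<close> is given on representatives; respecting almost-everywhere equality
  makes it a map of classes, and linearity is required of classes only.
\<close>

definition Lp_bounded_operator ::
  "ennreal \<Rightarrow> ((real^'d \<Rightarrow> complex) \<Rightarrow> (real^'d \<Rightarrow> complex)) \<Rightarrow> bool" where
  "Lp_bounded_operator p S \<longleftrightarrow>
     (\<forall>f\<in>Lp_space p. S f \<in> Lp_space p) \<and>
     (\<forall>f\<in>Lp_space p. \<forall>g\<in>Lp_space p.
        (AE x in lborel. f x = g x) \<longrightarrow> (AE x in lborel. S f x = S g x)) \<and>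
     (\<forall>f\<in>Lp_space p. \<forall>g\<in>Lp_space p.
        AE x in lborel. S (\<lambda>t. f t + g t) x = S f x + S g x) \<and>
     (\<forall>c. \<forall>f\<in>Lp_space p. AE x in lborel. S (\<lambda>t. c * f t) x = c * S f x) \<and>
     (\<exists>B. \<forall>f\<in>Lp_space p. Lp_norm p (S f) \<le> B * Lp_norm p f)"

definition Lp_stable ::
  "ennreal \<Rightarrow> ((real^'d \<Rightarrow> complex) \<Rightarrow> (real^'d \<Rightarrow> complex)) \<Rightarrow> bool" where
  "Lp_stable p S \<longleftrightarrow>
     Lp_bounded_operator p S \<and>
     (\<exists>C>0. \<forall>f\<in>Lp_space p.
        inverse C * Lp_norm p f \<le> Lp_norm p (S f) \<and> Lp_norm p (S f) \<le> C * Lp_norm p f)"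

text \<open>
  The Wiener amalgam norm is only applied to nonnegative functions, possibly with value
  \<open>\<infinity>\<close>; hence the type \<open>ennreal\<close>, in which every supremum and every infinite sum exists,
  and no absolute value.
\<close>

definition wiener_norm :: "(real^'d \<Rightarrow> ennreal) \<Rightarrow> ennreal" where
  "wiener_norm \<phi> =
     (\<Sum>\<^sub>\<infinity>k\<in>(UNIV :: (int^'d) set).
        SUP x\<in>{x. \<forall>i. 0 \<le> x $ i \<and> x $ i < 1}. \<phi> ((\<chi> i. of_int (k $ i)) + x))"

text \<open>The norm of a pair is the Euclidean norm on the product \<open>\<real>\<^sup>d \<times> \<real>\<^sup>d\<close>.\<close>

definition modulus_of_continuity ::
  "real \<Rightarrow> (real^'d \<Rightarrow> real^'d \<Rightarrow> complex) \<Rightarrow> real^'d \<Rightarrow> real^'d \<Rightarrow> ennreal" where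
  "modulus_of_continuity \<delta> K x y =
     (SUP (x', y')\<in>{h. norm h \<le> \<delta>}. ennreal (norm (K (x + x') (y + y') - K x y)))"

definition integral_operator ::
  "(real^'d \<Rightarrow> real^'d \<Rightarrow> complex) \<Rightarrow> (real^'d \<Rightarrow> complex) \<Rightarrow> (real^'d \<Rightarrow> complex)" where
  "integral_operator K f = (\<lambda>x. LINT y|lborel. K x y * f y)"

end

theory Submission
  imports Defs "HOL-Probability.Distributions"
begin

text \<open>
  Write \<open>S = I + T\<close> and cut a function \<open>v\<close> off with the weights \<open>\<psi>\<^sub>z(x) = exp (- a |x - z|\<^sub>1)\<close>. Applying
  \<open>L\<^sup>p\<close>-stability to \<open>\<psi>\<^sub>z v\<close> bounds \<open>\<alpha>(z) = \<parallel>\<psi>\<^sub>z v\<parallel>\<^sub>p\<close> by \<open>C \<beta>(z)\<close> with \<open>\<beta>(z) = \<parallel>\<psi>\<^sub>z S v\<parallel>\<^sub>p\<close>, plus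
  the contribution of the commutator \<open>[T, \<psi>\<^sub>z]\<close>, which is a convolution of \<open>\<alpha>\<close> with a kernel whose
  \<open>L\<^sup>1\<close>-norm tends to \<open>0\<close> with \<open>a\<close>. Taking \<open>L\<^sup>q\<close>-norms in \<open>z\<close> and absorbing that term gives
  \<open>\<parallel>\<alpha>\<parallel>\<^sub>q \<le> 2 C \<parallel>\<beta>\<parallel>\<^sub>q\<close>: the exponent \<open>q\<close> has entered while only local \<open>L\<^sup>p\<close>-norms were used.
  To leave the local norms again, one takes \<open>v = T f\<close>, for which \<open>S v = T (S f)\<close>. The amalgam
  condition on the kernel makes \<open>T\<close> locally smoothing, so that \<open>\<parallel>\<beta>\<parallel>\<^sub>q\<close> is bounded by a multiple of
  \<open>\<parallel>S f\<parallel>\<^sub>q\<close> and \<open>\<parallel>T v\<parallel>\<^sub>q\<close> by a multiple of \<open>\<parallel>\<alpha>\<parallel>\<^sub>q\<close>, and \<open>f = S f - T (S f) + T v\<close>. The modulus of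
  continuity enters only through the measurability of the kernel.
\<close>

section \<open>Extended \<open>L\<^sup>p\<close>-norms and Minkowski's integral inequality\<close>

text \<open>With \<open>young \<infinity>\<close> vanishing on \<open>[0, 1]\<close> and infinite beyond it, \<open>eLp p\<close> is the Luxemburg norm of
  \<open>young p\<close> for every \<open>p \<ge> 1\<close> (\<open>eLp_le_iff\<close> below), which allows a uniform treatment of \<open>p = \<infinity>\<close>.\<close>

definition young :: "ennreal \<Rightarrow> ennreal \<Rightarrow> ennreal" where
  "young p s =
     (if p = \<infinity> then (if s \<le> 1 then 0 else \<infinity>)
      else if s = \<infinity> then \<infinity> else ennreal (enn2real s powr enn2real p))"

definition eLp :: "ennreal \<Rightarrow> ('a::euclidean_space \<Rightarrow> ennreal) \<Rightarrow> ennreal" where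
  "eLp p F =
     (if p = \<infinity> then esssup lborel F
      else young (1 / p) (\<integral>\<^sup>+x. young p (F x) \<partial>lborel))"

section \<open>Elementary properties of \<open>young\<close>, Jensen's inequality and the Luxemburg
  description\<close>

lemma young_measurable[measurable]: "young p \<in> borel_measurable borel"
  unfolding young_def by measurable

lemma young_mono: "s \<le> t \<Longrightarrow> young p s \<le> young p t"
  by (auto simp: young_def top_unique enn2real_mono powr_mono2 less_top intro!: ennreal_leI)

lemma ge1_cases:
  assumes "1 \<le> (p::ennreal)"
  obtains "p = \<infinity>" | r where "p = ennreal r" "1 \<le> r"
  using assms by (cases p) (auto simp: ennreal_1[symmetric] simp del: ennreal_1)

text \<open>For \<open>s > 1\<close> the power dominates \<open>s\<close> because
  \<open>p \<ge> 1\<close>; otherwise \<open>1\<close> does. A finite modular thus controls the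
  function itself on sets of finite measure, which stands in for Hoelder's inequality below.\<close>

lemma le_one_plus_young:
  assumes "1 \<le> p" shows "s \<le> 1 + young p s"
  using assms
proof (cases rule: ge1_cases)
  case (2 r)
  show ?thesis
  proof (cases s)
    case (real x)
    have "x \<le> 1 + x powr r"
    proof (cases "x \<le> 1")
      case False
      then have "x powr 1 \<le> x powr r" using 2 by (intro powr_mono) auto
      then show ?thesis using False by simp
    qed (simp add: add_increasing2)
    then show ?thesis using real 2
      by (simp add: young_def flip: ennreal_1 ennreal_plus)
  qed (use 2 in \<open>simp add: young_def\<close>)
qed (auto simp: young_def)

lemma young_le_self:
  assumes "1 \<le> p" "s \<le> 1" shows "young p s \<le> s"
  using assms(1)
proof (cases rule: ge1_cases)
  case (2 r)
  obtain x where x: "s = ennreal x" "0 \<le> x" "x \<le> 1"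
    using assms(2) by (cases s) (auto simp: ennreal_1[symmetric] top_unique simp del: ennreal_1)
  have "x powr r \<le> x powr 1" using 2 x by (intro powr_mono') auto
  then show ?thesis using x 2 by (simp add: young_def)
qed (use assms in \<open>auto simp: young_def\<close>)

text \<open>The graph of \<open>x powr r\<close> lies above its tangent at \<open>a\<close>; this is
  Young's inequality with exponents \<open>r\<close> and \<open>r / (r - 1)\<close>. The negative
  term is moved across so that both sides are nonnegative and carry over to
  \<open>ennreal\<close>.\<close>

lemma powr_tangent:
  fixes r a x :: real
  assumes "1 \<le> r" "0 < a" "0 \<le> x"
  shows "r * a powr (r - 1) * x \<le> x powr r + (r - 1) * a powr r"
proof (cases "r = 1")
  case False
  have "x * a powr (r - 1) \<le> x powr r / r + (a powr (r-1)) powr (r/(r-1)) / (r/(r-1))"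
    using assms False by (intro Youngs_inequality) (auto simp: field_simps)
  also have "(a powr (r-1)) powr (r/(r-1)) = a powr r"
    using False by (simp add: powr_powr)
  finally have "r * (x * a powr (r - 1)) \<le> r * (x powr r / r + a powr r / (r/(r-1)))"
    using assms by (intro mult_left_mono) auto
  moreover have "r * (x powr r / r + a powr r / (r/(r-1))) = x powr r + (r - 1) * a powr r"
    using assms False by (simp add: distrib_left)
  ultimately show ?thesis by (simp add: mult_ac)
qed (use assms in simp)

text \<open>For finite \<open>p\<close>, integrate the tangent inequality at the mean. For
  \<open>p = \<infinity>\<close>, a finite right side forces \<open>g \<le> 1\<close> almost
  everywhere.\<close>

lemma young_jensen:
  assumes "1 \<le> p" "emeasure P (space P) = 1" and [measurable]: "g \<in> borel_measurable P"
  shows "young p (\<integral>\<^sup>+t. g t \<partial>P) \<le> (\<integral>\<^sup>+t. young p (g t) \<partial>P)"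
proof -
  have int1: "(\<integral>\<^sup>+t. c \<partial>P) = c" for c :: ennreal
    using assms(2) by simp
  let ?I = "\<integral>\<^sup>+t. young p (g t) \<partial>P" and ?A = "\<integral>\<^sup>+t. g t \<partial>P"
  show ?thesis
  proof (cases "?I = \<infinity>")
    case False
    from assms(1) show ?thesis
    proof (cases rule: ge1_cases)
      case 1
      have "AE t in P. young p (g t) \<noteq> \<infinity>"
        using False by (intro nn_integral_PInf_AE) auto
      then have "AE t in P. g t \<le> 1"
        by (auto simp: young_def 1 split: if_splits)
      then have "?A \<le> (\<integral>\<^sup>+t. 1 \<partial>P)" by (intro nn_integral_mono_AE)
      then show ?thesis by (simp add: int1 young_def 1 assms(2))
    next
      case (2 r)
      \<comment> \<open>The mean must be known to be finite before a tangent can be taken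
        there.\<close>
      have "?A \<le> (\<integral>\<^sup>+t. 1 + young p (g t) \<partial>P)"
        by (intro nn_integral_mono le_one_plus_young assms)
      also have "\<dots> = 1 + ?I" by (subst nn_integral_add) (auto simp: assms(2))
      also have "\<dots> < \<infinity>" using False by (simp add: less_top)
      finally obtain a where a: "?A = ennreal a" "0 \<le> a" by (cases ?A) auto
      show ?thesis
      proof (cases "a = 0")
        case False
        then have a0: "0 < a" using a by simp
        have tang: "ennreal (r * a powr (r - 1)) * s \<le> young p s + ennreal ((r - 1) * a powr r)" for s
        proof (cases s)
          case (real x)
          then show ?thesis using powr_tangent[of r a x] 2 a0
            by (auto simp: young_def simp flip: ennreal_mult ennreal_plus intro!: ennreal_leI)
        qed (simp add: young_def 2)
        have ra: "r * a powr (r-1) * a = r * a powr r"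
          using a0 by (simp add: powr_diff)
        have "ennreal (a powr r) + ennreal ((r - 1) * a powr r) = ennreal (r * a powr r)"
          using 2 a0 by (simp add: algebra_simps flip: ennreal_plus)
        also have "\<dots> = ennreal (r * a powr (r - 1)) * ?A"
          using 2 a0 by (simp add: a ra flip: ennreal_mult)
        also have "\<dots> = (\<integral>\<^sup>+t. ennreal (r * a powr (r - 1)) * g t \<partial>P)"
          by (simp add: nn_integral_cmult)
        also have "\<dots> \<le> (\<integral>\<^sup>+t. young p (g t) + ennreal ((r - 1) * a powr r) \<partial>P)"
          by (intro nn_integral_mono tang)
        also have "\<dots> = ?I + ennreal ((r - 1) * a powr r)"
          by (subst nn_integral_add) (auto simp: assms(2))
        finally have "ennreal (a powr r) \<le> ?I"
          using False \<open>?I \<noteq> \<infinity>\<close> 2 by (cases ?I) (auto simp flip: ennreal_plus)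
        then show ?thesis using 2 a0 by (simp add: a young_def)
      qed (use a 2 in \<open>simp add: young_def\<close>)
    qed
  qed simp
qed

lemma young_mult:
  assumes "p \<noteq> \<infinity>" "0 < p" shows "young p (s * t) = young p s * young p t"
proof -
  obtain r where r: "p = ennreal r" "0 < r" using assms by (cases p) auto
  show ?thesis
    using r by (cases s; cases t)
       (auto simp: young_def enn2real_mult powr_mult ennreal_mult ennreal_mult_eq_top_iff ennreal_top_mult ennreal_mult_top)
qed

lemma eLp_le_iff:
  fixes F :: "'a::euclidean_space \<Rightarrow> ennreal"
  assumes "1 \<le> p" "0 < c" "c < \<infinity>" and [measurable]: "F \<in> borel_measurable borel"
  shows "eLp p F \<le> c \<longleftrightarrow> (\<integral>\<^sup>+x. young p (F x / c) \<partial>lborel) \<le> 1"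
proof -
  obtain b where b: "c = ennreal b" "0 < b" using assms by (cases c) auto
  from assms(1) show ?thesis
  proof (cases rule: ge1_cases)
    case 1
    \<comment> \<open>The modular takes only the values \<open>0\<close> and
      \<open>\<infinity>\<close>, so being at most \<open>1\<close> means that the set where
      \<open>F\<close> exceeds \<open>c\<close> is null.\<close>
    have eq: "young p (F x / c) = \<infinity> * indicator {x. \<not> F x \<le> c} x" for x
    proof -
      have "F x / c \<le> 1 \<longleftrightarrow> F x \<le> c"
        using b by (cases "F x") (auto simp: divide_ennreal ennreal_top_divide top_unique simp flip: ennreal_1)
      then show ?thesis by (simp add: young_def 1)
    qed
    have "(\<integral>\<^sup>+x. young p (F x / c) \<partial>lborel) = \<infinity> * emeasure lborel {x. \<not> F x \<le> c}"
      unfolding eq by (subst nn_integral_cmult_indicator) auto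
    then have "(\<integral>\<^sup>+x. young p (F x / c) \<partial>lborel) \<le> 1 \<longleftrightarrow> emeasure lborel {x. \<not> F x \<le> c} = 0"
      by (auto simp: ennreal_top_mult top_unique)
    also have "\<dots> \<longleftrightarrow> (AE x in lborel. F x \<le> c)"
      by (subst AE_iff_measurable[OF _ refl]) auto
    also have "\<dots> \<longleftrightarrow> esssup lborel F \<le> c"
      using esssup_AE[where M=lborel and f=F] esssup_I[of F lborel c]
      by (auto elim: eventually_mono order_trans)
    finally show ?thesis by (simp add: eLp_def 1)
  next
    case (2 r)
    let ?I = "\<integral>\<^sup>+x. young p (F x) \<partial>lborel"
    have pp: "p \<noteq> \<infinity>" "0 < p" using 2 by auto
    have "(\<integral>\<^sup>+x. young p (F x / c) \<partial>lborel) = ?I * young p (inverse c)"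
      by (simp add: divide_ennreal_def young_mult[OF pp] nn_integral_multc)
    also have "young p (inverse c) = inverse (ennreal (b powr r))"
      using b 2 by (simp add: young_def inverse_ennreal powr_minus inverse_powr)
    finally have *: "(\<integral>\<^sup>+x. young p (F x / c) \<partial>lborel) = ?I / ennreal (b powr r)"
      by (simp add: divide_ennreal_def)
    have "1 / p = ennreal (1 / r)"
      using 2 by (simp add: divide_ennreal flip: ennreal_1)
    then have "eLp p F = young (ennreal (1/r)) ?I" using 2 by (simp add: eLp_def)
    also have "\<dots> \<le> c \<longleftrightarrow> ?I \<le> ennreal (b powr r)"
    proof (cases ?I)
      case (real i)
      have "i powr (1/r) \<le> b \<longleftrightarrow> i \<le> b powr r"
        using 2 b real powr_mono2[of r "i powr (1/r)" b] powr_mono2[of "1/r" i "b powr r"]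
        by (auto simp: powr_powr)
      then show ?thesis using real b 2 by (simp add: young_def)
    qed (use 2 b in \<open>simp add: young_def top_unique\<close>)
    also have "\<dots> \<longleftrightarrow> ?I / ennreal (b powr r) \<le> 1"
      using b by (cases ?I) (auto simp: divide_ennreal ennreal_top_divide field_simps top_unique)
    finally show ?thesis using * by simp
  qed
qed

text \<open>\<open>eLp_le_iff\<close> describes only positive finite bounds. This turns statements
  about such bounds into an inequality of norms, reaching a zero norm by density.\<close>

lemma ennreal_le_mult_of_bounds:
  fixes a b k :: ennreal
  assumes "0 < k" "k < \<infinity>" and *: "\<And>c. 0 < c \<Longrightarrow> c < \<infinity> \<Longrightarrow> a \<le> c \<Longrightarrow> b \<le> k * c"
  shows "b \<le> k * a"
proof (cases "a = \<infinity>")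
  case False
  have "b / k \<le> c" if "a < c" for c
  proof (cases "c = \<infinity>")
    case False
    then have "b \<le> k * c" using that by (intro *) (auto simp: less_top intro: le_less_trans)
    then show ?thesis using assms
      by (intro divide_le_posI_ennreal) (auto simp: mult.commute)
  qed simp
  then have "b / k \<le> a" by (rule dense_ge)
  then have "k * (b / k) \<le> k * a" by (rule mult_left_mono) simp
  moreover have "k * (b / k) = b"
    using assms by (metis ennreal_mult_divide_eq ennreal_times_divide infinity_ennreal_def less_irrefl mult.commute)
  ultimately show ?thesis by simp
qed (use assms in \<open>simp add: ennreal_mult_top\<close>)

lemma eLp_mono_AE:
  assumes [measurable]: "F \<in> borel_measurable borel" and *: "AE x in lborel. F x \<le> G x"
  shows "eLp p F \<le> eLp p G"
proof -
  have "(\<integral>\<^sup>+x. young p (F x) \<partial>lborel) \<le> (\<integral>\<^sup>+x. young p (G x) \<partial>lborel)"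
    using * by (intro nn_integral_mono_AE) (auto elim!: eventually_mono intro: young_mono)
  then show ?thesis
    using * by (auto simp: eLp_def intro!: young_mono esssup_AE_mono)
qed

lemma eLp_mono:
  assumes "F \<in> borel_measurable borel" "\<And>x. F x \<le> G x"
  shows "eLp p F \<le> eLp p G"
  using assms by (intro eLp_mono_AE) auto

lemma eLp_cmult:
  assumes "1 \<le> p" "k < \<infinity>" and [measurable]: "F \<in> borel_measurable borel"
  shows "eLp p (\<lambda>x. k * F x) \<le> k * eLp p F"
\<comment> \<open>\<open>ennreal_le_mult_of_bounds\<close> asks for a positive factor, so the zero
  function is treated directly: its modular is \<open>0\<close> at every scale.\<close>
proof (cases "k = 0")
  case True
  have "eLp p (\<lambda>x. 0 :: ennreal) \<le> c" if "0 < c" for c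
  proof (cases "c = \<infinity>")
    case False
    then show ?thesis using that young_le_self[of p 0] assms
      by (subst eLp_le_iff) (auto simp: less_top)
  qed simp
  then have "eLp p (\<lambda>x. 0 :: ennreal) \<le> 0" by (rule dense_ge)
  then show ?thesis using True by simp
next
  case False
  show ?thesis
  proof (rule ennreal_le_mult_of_bounds)
    fix c assume c: "0 < c" "c < \<infinity>" "eLp p F \<le> c"
    have eq: "k * x / (k * c) = x / c" for x
      using False assms c
      by (cases k; cases c; cases x)
         (auto simp: divide_ennreal ennreal_mult_top ennreal_top_divide simp flip: ennreal_mult)
    show "eLp p (\<lambda>x. k * F x) \<le> k * c"
      using c assms False
      by (subst eLp_le_iff) (auto simp: eq eLp_le_iff[symmetric] ennreal_mult_less_top ennreal_zero_less_mult_iff zero_less_iff_neq_zero)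
  qed (use False assms in \<open>auto simp: zero_less_iff_neq_zero\<close>)
qed

text \<open>By \<open>eLp_le_iff\<close> the norm depends only on the distribution of
  \<open>F\<close>. Its invariance under a map thus reduces to that of Lebesgue measure, for
  \<open>p = \<infinity>\<close> as well.\<close>

lemma eLp_cong_distr:
  assumes "1 \<le> p" and [measurable]: "F \<in> borel_measurable borel" "G \<in> borel_measurable borel"
    and *: "\<And>\<phi> :: ennreal \<Rightarrow> ennreal. \<phi> \<in> borel_measurable borel \<Longrightarrow>
              (\<integral>\<^sup>+x. \<phi> (F x) \<partial>lborel) = (\<integral>\<^sup>+x. \<phi> (G x) \<partial>lborel)"
  shows "eLp p F = eLp p G"
proof -
  have iff: "eLp p F \<le> c \<longleftrightarrow> eLp p G \<le> c" if "0 < c" "c < \<infinity>" for c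
    using that assms *[of "\<lambda>s. young p (s / c)"] by (simp add: eLp_le_iff)
  have "eLp p F \<le> 1 * eLp p G" "eLp p G \<le> 1 * eLp p F"
    by (rule ennreal_le_mult_of_bounds; simp add: iff)+
  then show ?thesis by simp
qed

section \<open>Invariance of the norms under translation and reflection\<close>

lemma nn_integral_lborel_translate:
  fixes f :: "'a::euclidean_space \<Rightarrow> ennreal"
  assumes "f \<in> borel_measurable borel"
  shows "(\<integral>\<^sup>+x. f (x + a) \<partial>lborel) = (\<integral>\<^sup>+x. f x \<partial>lborel)"
  using assms by (subst (2) lborel_distr_plus[of a, symmetric])
    (simp add: nn_integral_distr add.commute)

lemma nn_integral_lborel_reflect:
  fixes f :: "'a::euclidean_space \<Rightarrow> ennreal"
  assumes "f \<in> borel_measurable borel"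
  shows "(\<integral>\<^sup>+x. f (a - x) \<partial>lborel) = (\<integral>\<^sup>+x. f x \<partial>lborel)"
  using assms by (subst (2) lborel_affine[of "-1" a])
    (simp_all add: nn_integral_distr density_1)

lemma eLp_translate:
  assumes "1 \<le> p" "F \<in> borel_measurable borel"
  shows "eLp p (\<lambda>x. F (x + a)) = eLp p F"
proof -
  note [measurable] = assms(2)
  show ?thesis
    using assms by (intro eLp_cong_distr nn_integral_lborel_translate[where f="\<lambda>x. _ (F x)"]) auto
qed

lemma eLp_reflect:
  assumes "1 \<le> p" "F \<in> borel_measurable borel"
  shows "eLp p (\<lambda>x. F (a - x)) = eLp p F"
proof -
  note [measurable] = assms(2)
  show ?thesis
    using assms by (intro eLp_cong_distr nn_integral_lborel_reflect[where f="\<lambda>x. _ (F x)"]) auto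
qed

lemma eLp_AE_finite:
  assumes "1 \<le> p" "eLp p F < \<infinity>" and [measurable]: "F \<in> borel_measurable borel"
  shows "AE x in lborel. F x < \<infinity>"
proof -
  \<comment> \<open>The added \<open>1\<close> keeps the scale positive when the norm is
    zero.\<close>
  let ?c = "eLp p F + 1"
  have c: "0 < ?c" "?c < \<infinity>" using assms by (auto simp: less_top zero_less_iff_neq_zero)
  have "(\<integral>\<^sup>+x. young p (F x / ?c) \<partial>lborel) \<le> 1"
    using c assms by (subst eLp_le_iff[symmetric]) auto
  then have "AE x in lborel. young p (F x / ?c) \<noteq> \<infinity>"
    by (intro nn_integral_PInf_AE) (auto simp: top_unique)
  then show ?thesis
  proof (rule eventually_mono)
    fix x assume "young p (F x / ?c) \<noteq> \<infinity>"
    then have "1 + young p (F x / ?c) < \<infinity>" by (simp add: less_top)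
    then have "F x / ?c < \<infinity>" using le_one_plus_young[OF assms(1)] le_less_trans by blast
    then show "F x < \<infinity>"
      using assms(2) by (cases "F x") (auto simp: ennreal_top_divide split: if_splits)
  qed
qed

text \<open>Through \<open>eLp_le_iff\<close> a sublevel set becomes a condition on an integral with
  a parameter, measurable by Tonelli; this covers the essential supremum too. Level \<open>0\<close>
  is the intersection of the levels \<open>1 / Suc n\<close>.\<close>

lemma eLp_measurable:
  fixes F :: "'a::euclidean_space \<Rightarrow> 't \<Rightarrow> ennreal"
  assumes p: "1 \<le> p" and [measurable]: "(\<lambda>(x, t). F x t) \<in> borel_measurable (borel \<Otimes>\<^sub>M N)"
  shows "(\<lambda>t. eLp p (\<lambda>x. F x t)) \<in> borel_measurable N"
proof -
  have Ft[measurable]: "(\<lambda>x. F x t) \<in> borel_measurable borel" if "t \<in> space N" for t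
    using that by measurable
  define A where "A c = {t \<in> space N. (\<integral>\<^sup>+x. young p (F x t / c) \<partial>lborel) \<le> 1}" for c
  have [measurable]: "A c \<in> sets N" for c unfolding A_def by measurable
  have A: "{t \<in> space N. eLp p (\<lambda>x. F x t) \<le> c} = A c" if "0 < c" "c < \<infinity>" for c
    using that p by (auto simp: eLp_le_iff A_def)
  show ?thesis
  proof (rule borel_measurableI_le)
    fix y :: ennreal
    consider "y = \<infinity>" | "y = 0" | "0 < y" "y < \<infinity>" by (metis infinity_ennreal_def less_top not_gr_zero)
    then show "{t \<in> space N. eLp p (\<lambda>x. F x t) \<le> y} \<in> sets N"
    proof cases
      case 2
      have "(e \<le> 0) \<longleftrightarrow> (\<forall>n. e \<le> ennreal (1 / Suc n))" for e :: ennreal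
      proof
        assume *: "\<forall>n. e \<le> ennreal (1 / Suc n)"
        have "(\<lambda>n. ennreal (1 / Suc n)) \<longlonglongrightarrow> ennreal 0"
          by (intro tendsto_ennrealI LIMSEQ_inverse_real_of_nat[unfolded inverse_eq_divide])
        then show "e \<le> 0" using * by (intro LIMSEQ_le_const) auto
      qed simp
      then have "{t \<in> space N. eLp p (\<lambda>x. F x t) \<le> y}
          = (\<Inter>n. {t \<in> space N. eLp p (\<lambda>x. F x t) \<le> ennreal (1 / Suc n)})"
        unfolding \<open>y = 0\<close> by blast
      also have "\<dots> = (\<Inter>n. A (ennreal (1 / Suc n)))" by (subst A) auto
      finally show ?thesis by simp
    qed (auto simp: A)
  qed
qed

text \<open>Normalizing by \<open>m t\<close>, which is the norm of \<open>F (\<cdot>, t)\<close> made strictly positive by \<open>e * \<rho> t\<close>, turns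
  \<open>m N\<close> into a multiple of a probability measure, and Jensen's inequality for \<open>young p\<close> applies.\<close>

lemma eLp_nn_integral_le:
  fixes F :: "'a::euclidean_space \<Rightarrow> 't \<Rightarrow> ennreal"
  assumes p: "1 \<le> p" and "sigma_finite_measure N"
    and [measurable]: "(\<lambda>(x, t). F x t) \<in> borel_measurable (borel \<Otimes>\<^sub>M N)"
  shows "eLp p (\<lambda>x. \<integral>\<^sup>+t. F x t \<partial>N) \<le> (\<integral>\<^sup>+t. eLp p (\<lambda>x. F x t) \<partial>N)"
proof -
  interpret N: sigma_finite_measure N by fact
  interpret pair_sigma_finite lborel N ..
  have meas[measurable]: "(\<lambda>t. eLp p (\<lambda>x. F x t)) \<in> borel_measurable N"
    by (rule eLp_measurable) (use assms in auto)
  have Ft[measurable]: "(\<lambda>x. F x t) \<in> borel_measurable borel" if "t \<in> space N" for t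
    using that by measurable
  have [measurable]: "(\<lambda>x. \<integral>\<^sup>+t. F x t \<partial>N) \<in> borel_measurable borel"
    by measurable
  let ?M = "\<integral>\<^sup>+t. eLp p (\<lambda>x. F x t) \<partial>N"
  \<comment> \<open>Sigma-finiteness supplies a strictly positive function of finite integral, which
    keeps the normalization \<open>m\<close> positive.\<close>
  obtain \<rho> where [measurable]: "\<rho> \<in> borel_measurable N" and \<rho>: "integral\<^sup>N N \<rho> \<noteq> \<infinity>"
      "\<And>t. t \<in> space N \<Longrightarrow> 0 < \<rho> t \<and> \<rho> t < \<infinity>"
    using N.Ex_finite_integrable_function by auto
  let ?R = "integral\<^sup>N N \<rho>"
  show ?thesis
  \<comment> \<open>An infinite right side leaves nothing to prove, and \<open>?R = 0\<close> means
    that \<open>N\<close> is the null measure.\<close>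
  proof (cases "?M = \<infinity> \<or> ?R = 0")
    case True
    then show ?thesis
    proof
      assume "?R = 0"
      then have "AE t in N. \<rho> t = 0" by (simp add: nn_integral_0_iff_AE)
      then have "AE t in N. False"
        by (rule AE_mp) (use \<rho>(2) in \<open>force intro!: AE_I2\<close>)
      then have 0: "(\<integral>\<^sup>+t. G t \<partial>N) = 0" for G :: "'t \<Rightarrow> ennreal"
        by (subst nn_integral_cong_AE[where v="\<lambda>_. 0"]) (auto elim: eventually_mono)
      show ?thesis using eLp_cmult[of p 0 "\<lambda>_. 0"] p by (simp add: 0)
    qed simp
  next
    case False
    have key: "eLp p (\<lambda>x. \<integral>\<^sup>+t. F x t \<partial>N) \<le> ?M + e * ?R" if e: "0 < e" "e < \<infinity>" for e :: ennreal
    proof -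
      define m where "m t = eLp p (\<lambda>x. F x t) + e * \<rho> t" for t
      have [measurable]: "m \<in> borel_measurable N" unfolding m_def by measurable
      define M where "M = ?M + e * ?R"
      have M: "integral\<^sup>N N m = M"
        unfolding m_def M_def by (subst nn_integral_add) (auto simp: nn_integral_cmult)
      have M0: "0 < M" "M < \<infinity>"
        using False e \<rho> by (auto simp: M_def ennreal_mult_less_top less_top zero_less_iff_neq_zero)
      have m0: "0 < m t" if "t \<in> space N" for t
        using \<rho>(2)[OF that] e by (auto simp: m_def zero_less_iff_neq_zero)
      have minf: "AE t in N. m t < \<infinity>"
        using M M0 nn_integral_PInf_AE[of m N] by (auto simp: less_top)
      define P where "P = density N (\<lambda>t. m t / M)"
      have P1: "emeasure P (space P) = 1"
        using M0 by (simp add: P_def emeasure_density nn_integral_divide M ennreal_divide_self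
            cong: nn_integral_cong)
      have [measurable_cong]: "sets P = sets N" by (simp add: P_def)
      have eq: "(\<integral>\<^sup>+t. F x t \<partial>N) / M = (\<integral>\<^sup>+t. F x t / m t \<partial>P)" for x
      proof -
        have "(\<integral>\<^sup>+t. F x t / m t \<partial>P) = (\<integral>\<^sup>+t. m t / M * (F x t / m t) \<partial>N)"
          unfolding P_def by (subst nn_integral_density) auto
        also have "\<dots> = (\<integral>\<^sup>+t. F x t / M \<partial>N)"
        proof (rule nn_integral_cong_AE)
          show "AE t in N. m t / M * (F x t / m t) = F x t / M"
            using minf
          proof (rule AE_mp, intro AE_I2 impI)
            fix t assume t: "t \<in> space N" "m t < \<infinity>"
            then have "m t * inverse (m t) = 1"
              using m0[of t] by (metis divide_ennreal_def ennreal_divide_self infinity_ennreal_def less_irrefl)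
            then show "m t / M * (F x t / m t) = F x t / M"
              by (simp add: divide_ennreal_def mult_ac)
          qed
        qed
        also have "\<dots> = (\<integral>\<^sup>+t. F x t \<partial>N) / M" by (rule nn_integral_divide) simp
        finally show ?thesis by simp
      qed
      have le1: "AE t in N. (\<integral>\<^sup>+x. young p (F x t / m t) \<partial>lborel) \<le> 1"
        using minf
      proof (rule AE_mp, intro AE_I2 impI)
        fix t assume "t \<in> space N" "m t < \<infinity>"
        then show "(\<integral>\<^sup>+x. young p (F x t / m t) \<partial>lborel) \<le> 1"
          using p m0 by (subst eLp_le_iff[symmetric]) (auto simp: m_def)
      qed
      \<comment> \<open>Jensen in \<open>t\<close>, then Tonelli, then \<open>le1\<close>: almost
        every normalized slice has modular at most \<open>1\<close>.\<close>
      have "(\<integral>\<^sup>+x. young p ((\<integral>\<^sup>+t. F x t \<partial>N) / M) \<partial>lborel)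
          \<le> (\<integral>\<^sup>+x. (\<integral>\<^sup>+t. young p (F x t / m t) \<partial>P) \<partial>lborel)"
        unfolding eq using p P1 by (intro nn_integral_mono young_jensen) auto
      also have "\<dots> = (\<integral>\<^sup>+x. (\<integral>\<^sup>+t. m t / M * young p (F x t / m t) \<partial>N) \<partial>lborel)"
        unfolding P_def by (subst nn_integral_density) auto
      also have "\<dots> = (\<integral>\<^sup>+t. (\<integral>\<^sup>+x. m t / M * young p (F x t / m t) \<partial>lborel) \<partial>N)"
        by (rule Fubini'[symmetric]) measurable
      also have "\<dots> = (\<integral>\<^sup>+t. m t / M * (\<integral>\<^sup>+x. young p (F x t / m t) \<partial>lborel) \<partial>N)"
        by (intro nn_integral_cong nn_integral_cmult) measurable
      also have "\<dots> \<le> (\<integral>\<^sup>+t. m t / M * 1 \<partial>N)"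
        using le1 by (intro nn_integral_mono_AE, elim eventually_mono, intro mult_left_mono) auto
      also have "\<dots> = 1"
        using M0 by (simp add: nn_integral_divide M ennreal_divide_self)
      finally show ?thesis
        using p M0 unfolding M_def[symmetric] by (subst eLp_le_iff) auto
    qed
    have fin: "?M < \<infinity>" "?R < \<infinity>" "0 < ?R" using False \<rho> by (auto simp: less_top zero_less_iff_neq_zero)
    show ?thesis
    proof (rule ennreal_le_epsilon)
      fix e :: real assume e: "0 < e"
      \<comment> \<open>Applying \<open>key\<close> with this value makes the error term exactly
        \<open>ennreal e\<close>.\<close>
      have "0 < ennreal e / ?R" "ennreal e / ?R < \<infinity>"
        using e fin by (cases ?R; auto simp: divide_ennreal)+
      then have "eLp p (\<lambda>x. \<integral>\<^sup>+t. F x t \<partial>N) \<le> ?M + (ennreal e / ?R) * ?R" by (rule key)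
      also have "(ennreal e / ?R) * ?R = ennreal e"
        using fin by (simp add: ennreal_divide_times ennreal_mult_divide_eq less_top)
      finally show "eLp p (\<lambda>x. \<integral>\<^sup>+t. F x t \<partial>N) \<le> ?M + ennreal e" .
    qed
  qed
qed

text \<open>The triangle inequality is Minkowski's integral inequality over counting measure on the
  two Booleans.\<close>

lemma eLp_add:
  assumes p: "1 \<le> p" and [measurable]: "F \<in> borel_measurable borel" "G \<in> borel_measurable borel"
  shows "eLp p (\<lambda>x. F x + G x) \<le> eLp p F + eLp p G"
proof -
  have "eLp p (\<lambda>x. \<integral>\<^sup>+b. (if b then F x else G x) \<partial>count_space UNIV)
      \<le> (\<integral>\<^sup>+b. eLp p (\<lambda>x. if b then F x else G x) \<partial>count_space UNIV)"
    using p by (intro eLp_nn_integral_le sigma_finite_measure_count_space_countable) auto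
  then show ?thesis
    by (simp add: nn_integral_count_space_finite UNIV_bool add.commute)
qed

lemma eLp_nn_integral_mult_le:
  assumes p: "1 \<le> p" and [measurable]: "k \<in> borel_measurable borel"
      "(\<lambda>(x, t). F x t) \<in> borel_measurable (borel \<Otimes>\<^sub>M borel)"
    and fin: "AE t in lborel. k t < \<infinity>"
  shows "eLp p (\<lambda>x. \<integral>\<^sup>+t. k t * F x t \<partial>lborel) \<le> (\<integral>\<^sup>+t. k t * eLp p (\<lambda>x. F x t) \<partial>lborel)"
proof -
  have "eLp p (\<lambda>x. \<integral>\<^sup>+t. k t * F x t \<partial>lborel) \<le> (\<integral>\<^sup>+t. eLp p (\<lambda>x. k t * F x t) \<partial>lborel)"
    using p by (intro eLp_nn_integral_le) (auto simp: lborel.sigma_finite_measure_axioms)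
  also have "\<dots> \<le> (\<integral>\<^sup>+t. k t * eLp p (\<lambda>x. F x t) \<partial>lborel)"
    using fin
  proof (intro nn_integral_mono_AE, elim eventually_mono)
    fix t assume "k t < \<infinity>"
    then show "eLp p (\<lambda>x. k t * F x t) \<le> k t * eLp p (\<lambda>x. F x t)"
      using p by (intro eLp_cmult) auto
  qed
  finally show ?thesis .
qed

text \<open>Young's convolution inequality for an integrable kernel: Minkowski's inequality in
  \<open>t\<close> and translation invariance.\<close>

lemma eLp_convolution:
  assumes p: "1 \<le> p" and [measurable]: "k \<in> borel_measurable borel" "F \<in> borel_measurable borel"
    and fin: "(\<integral>\<^sup>+t. k t \<partial>lborel) < \<infinity>"
  shows "eLp p (\<lambda>x. \<integral>\<^sup>+t. k t * F (x + t) \<partial>lborel) \<le> (\<integral>\<^sup>+t. k t \<partial>lborel) * eLp p F"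
proof -
  have "AE t in lborel. k t \<noteq> \<infinity>"
    using fin by (intro nn_integral_PInf_AE) auto
  then have "eLp p (\<lambda>x. \<integral>\<^sup>+t. k t * F (x + t) \<partial>lborel) \<le> (\<integral>\<^sup>+t. k t * eLp p (\<lambda>x. F (x + t)) \<partial>lborel)"
    using p by (intro eLp_nn_integral_mult_le) (auto simp: less_top)
  also have "\<dots> = (\<integral>\<^sup>+t. k t \<partial>lborel) * eLp p F"
    using p by (simp add: eLp_translate nn_integral_multc)
  finally show ?thesis .
qed

text \<open>A form of Hoelder's inequality without a conjugate exponent: scale \<open>F\<close> by a
  bound \<open>c\<close> on its norm and use \<open>s \<le> 1 + young p s\<close>. The
  \<open>1\<close> contributes the integral of \<open>w\<close>; the modular contributes at most
  \<open>1\<close> because \<open>w \<le> 1\<close>.\<close>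

lemma nn_integral_weighted_le_eLp:
  assumes p: "1 \<le> p" and [measurable]: "w \<in> borel_measurable borel" "F \<in> borel_measurable borel"
    and w: "\<And>x. w x \<le> 1" and fin: "(\<integral>\<^sup>+x. w x \<partial>lborel) < \<infinity>"
  shows "(\<integral>\<^sup>+x. w x * F x \<partial>lborel) \<le> ((\<integral>\<^sup>+x. w x \<partial>lborel) + 1) * eLp p F"
proof (rule ennreal_le_mult_of_bounds)
  fix c assume c: "0 < c" "c < \<infinity>" "eLp p F \<le> c"
  have "F x = (F x / c) * c" for x
    using c by (simp add: ennreal_divide_times ennreal_mult_divide_eq less_top)
  then have "(\<integral>\<^sup>+x. w x * F x \<partial>lborel) = (\<integral>\<^sup>+x. w x * (F x / c) * c \<partial>lborel)"
    by (simp add: mult.assoc)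
  also have "\<dots> = (\<integral>\<^sup>+x. w x * (F x / c) \<partial>lborel) * c"
    by (rule nn_integral_multc) simp
  also have "(\<integral>\<^sup>+x. w x * (F x / c) \<partial>lborel) \<le> (\<integral>\<^sup>+x. w x + young p (F x / c) \<partial>lborel)"
  proof (rule nn_integral_mono)
    fix x
    have "w x * (F x / c) \<le> w x * (1 + young p (F x / c))"
      by (intro mult_left_mono le_one_plus_young p) simp
    also have "\<dots> \<le> w x + 1 * young p (F x / c)"
      unfolding distrib_left by (intro add_mono mult_right_mono w) auto
    finally show "w x * (F x / c) \<le> w x + young p (F x / c)" by simp
  qed
  also have "\<dots> = (\<integral>\<^sup>+x. w x \<partial>lborel) + (\<integral>\<^sup>+x. young p (F x / c) \<partial>lborel)"
    by (rule nn_integral_add) auto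
  also have "(\<integral>\<^sup>+x. young p (F x / c) \<partial>lborel) \<le> 1"
    using c p by (simp add: eLp_le_iff)
  finally show "(\<integral>\<^sup>+x. w x * F x \<partial>lborel) \<le> ((\<integral>\<^sup>+x. w x \<partial>lborel) + 1) * c"
    by (simp add: mult_right_mono add_left_mono)
qed (use fin in \<open>auto simp: less_top zero_less_iff_neq_zero\<close>)

text \<open>At scale \<open>c\<close> the weight is at most \<open>1\<close>, where
  \<open>young p\<close> lies below the identity, so that the modular is at most the
  integral.\<close>

lemma eLp_weight_finite:
  assumes p: "1 \<le> p" and [measurable]: "w \<in> borel_measurable borel"
    and w: "\<And>x. w x \<le> 1" and fin: "(\<integral>\<^sup>+x. w x \<partial>lborel) < \<infinity>"
  shows "eLp p w < \<infinity>"
proof -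
  define c where "c = (\<integral>\<^sup>+x. w x \<partial>lborel) + 1"
  have c: "0 < c" "c < \<infinity>" using fin by (auto simp: c_def less_top zero_less_iff_neq_zero)
  have "(\<integral>\<^sup>+x. young p (w x / c) \<partial>lborel) \<le> (\<integral>\<^sup>+x. w x / c \<partial>lborel)"
  proof (intro nn_integral_mono young_le_self p)
    fix x show "w x / c \<le> 1"
      using c w[of x] by (intro divide_le_posI_ennreal) (auto simp: c_def add_increasing)
  qed
  also have "\<dots> = (\<integral>\<^sup>+x. w x \<partial>lborel) / c" by (rule nn_integral_divide) simp
  also have "\<dots> \<le> 1" using c by (intro divide_le_posI_ennreal) (auto simp: c_def)
  finally have "eLp p w \<le> c" using c p by (simp add: eLp_le_iff)
  then show ?thesis using c by simp
qed

section \<open>Exponential weights and the majorant of the kernel\<close>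

text \<open>The sum of coordinates, rather than the Euclidean norm, makes \<open>expw a\<close> a
  product over the coordinates (\<open>expw_eq_prod\<close>), so that its integrability reduces to
  the line.\<close>

definition l1 :: "'a::euclidean_space \<Rightarrow> real" where
  "l1 x = (\<Sum>b\<in>Basis. \<bar>x \<bullet> b\<bar>)"

definition expw :: "real \<Rightarrow> 'a::euclidean_space \<Rightarrow> real" where
  "expw a x = exp (- (a * l1 x))"

lemma l1_nonneg[simp]: "0 \<le> l1 x"
  by (simp add: l1_def sum_nonneg)

lemma l1_triangle: "l1 (x + y) \<le> l1 x + l1 y"
  unfolding l1_def sum.distrib[symmetric] by (intro sum_mono) (simp add: inner_add_left)

lemma l1_minus[simp]: "l1 (- x) = l1 x"
  by (simp add: l1_def)

lemma l1_measurable[measurable]: "l1 \<in> borel_measurable borel"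
  unfolding l1_def by measurable

lemma expw_measurable[measurable]: "expw a \<in> borel_measurable borel"
  unfolding expw_def by measurable

lemma expw_pos[simp]: "0 < expw a x" and expw_nonneg[simp]: "0 \<le> expw a x"
  by (auto simp: expw_def)

lemma expw_le_1[simp]: "0 \<le> a \<Longrightarrow> expw a x \<le> 1"
  by (simp add: expw_def)

lemma expw_minus[simp]: "expw a (- x) = expw a x"
  by (simp add: expw_def)

lemma expw_antimono: "a \<le> b \<Longrightarrow> expw b x \<le> expw a x"
  by (simp add: expw_def mult_right_mono)

lemma expw_mult: "expw a x * expw b x = expw (a + b) x"
  by (simp add: expw_def algebra_simps flip: exp_add)

lemma expw_add_ge: "0 \<le> a \<Longrightarrow> expw a x * expw a y \<le> expw a (x + y)"
  using l1_triangle[of x y] mult_left_mono[of "l1 (x + y)" "l1 x + l1 y" a]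
  by (simp add: expw_def algebra_simps flip: exp_add)

lemma nn_integral_exp_neg_abs_finite:
  fixes a :: real assumes "0 < a"
  shows "(\<integral>\<^sup>+x. ennreal (exp (- (a * \<bar>x\<bar>))) \<partial>lborel) < \<infinity>"
proof -
  let ?E = "\<lambda>x::real. ennreal (exp (- x)) * indicator {0..} x"
  have E: "(\<integral>\<^sup>+x. ?E x \<partial>lborel) = 1"
    using nn_intergal_power_times_exp_Ici[of 0] by simp
  have "(\<integral>\<^sup>+x. ?E (b * x) \<partial>lborel) < \<infinity>" if "b \<noteq> 0" for b :: real
  proof -
    have "\<bar>b\<bar> * (\<integral>\<^sup>+x. ?E (b * x) \<partial>lborel) = 1"
      using nn_integral_real_affine[of ?E b 0] that E by simp
    then show ?thesis using that
      by (cases "(\<integral>\<^sup>+x. ?E (b * x) \<partial>lborel)") (auto simp: ennreal_mult_top)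
  qed
  from this[of a] this[of "- a"]
  have "(\<integral>\<^sup>+x. ?E (a * x) + ?E (- a * x) \<partial>lborel) < \<infinity>"
    using assms by (subst nn_integral_add) auto
  moreover have "ennreal (exp (- (a * \<bar>x\<bar>))) \<le> ?E (a * x) + ?E (- a * x)" for x
    using assms by (cases "0 \<le> x") (auto simp: indicator_def zero_le_mult_iff mult_le_0_iff)
  ultimately show ?thesis
    by (rule le_less_trans[OF nn_integral_mono, rotated])
qed

lemma expw_eq_prod: "expw a x = (\<Prod>b\<in>Basis. exp (- (a * \<bar>x \<bullet> b\<bar>)))"
  by (simp add: expw_def l1_def sum_distrib_left sum_negf flip: exp_sum)

lemma nn_integral_expw_finite:
  assumes "0 < a" shows "(\<integral>\<^sup>+(x::'a::euclidean_space). ennreal (expw a x) \<partial>lborel) < \<infinity>"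
proof -
  have "(\<integral>\<^sup>+(x::'a). ennreal (expw a x) \<partial>lborel)
      = (\<integral>\<^sup>+(x::'a). (\<Prod>b\<in>Basis. ennreal (exp (- (a * \<bar>x \<bullet> b\<bar>)))) \<partial>lborel)"
    by (simp add: expw_eq_prod prod_ennreal)
  also have "\<dots> = (\<Prod>b\<in>(Basis::'a set). (\<integral>\<^sup>+x. ennreal (exp (- (a * \<bar>x\<bar>))) \<partial>lborel))"
    by (rule nn_integral_lborel_prod[where f="\<lambda>_ x. ennreal (exp (- (a * \<bar>x\<bar>)))"]) auto
  also have "\<dots> < \<infinity>"
    using nn_integral_exp_neg_abs_finite[OF assms] by (simp add: power_less_top_ennreal)
  finally show ?thesis .
qed

lemma nn_integral_expw_pos: "0 < (\<integral>\<^sup>+(x::'a::euclidean_space). ennreal (expw a x) \<partial>lborel)"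
proof (rule ccontr)
  assume "\<not> ?thesis"
  then have "AE x::'a in lborel. ennreal (expw a x) = 0"
    by (subst nn_integral_0_iff_AE[symmetric]) auto
  then have "AE x::'a in lborel. False"
    by (rule eventually_mono) (metis ennreal_eq_0_iff expw_pos not_le)
  then show False
    using emeasure_lborel_UNIV by (simp add: ae_filter_eq_bot_iff)
qed

text \<open>Bounds the relative change of \<open>expw a\<close> under a shift by \<open>t\<close>.
  Being at most \<open>1\<close> and tending to \<open>0\<close> with \<open>a\<close> for fixed
  \<open>t\<close>, it suits dominated convergence.\<close>

definition expw_lip :: "real \<Rightarrow> 'a::euclidean_space \<Rightarrow> real" where
  "expw_lip a t = min 1 (a * l1 t)"

lemma expw_lip_measurable[measurable]: "expw_lip a \<in> borel_measurable borel"
  unfolding expw_lip_def by measurable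

lemma expw_lip_nonneg[simp]: "0 \<le> a \<Longrightarrow> 0 \<le> expw_lip a t"
  by (simp add: expw_lip_def)

lemma expw_lip_le_1[simp]: "expw_lip a t \<le> 1"
  by (simp add: expw_lip_def)

lemma expw_diff_le_aux:
  assumes "0 \<le> a" shows "expw a x - expw a (x + t) \<le> expw_lip a t * expw a x"
proof -
  have "expw a x * expw a t \<le> expw a (x + t)" by (rule expw_add_ge) fact
  moreover have "1 - expw a t \<le> expw_lip a t"
    using exp_ge_add_one_self[of "- (a * l1 t)"] by (auto simp: expw_lip_def expw_def min_def)
  then have "(1 - expw a t) * expw a x \<le> expw_lip a t * expw a x"
    by (rule mult_right_mono) simp
  ultimately show ?thesis by (simp add: algebra_simps)
qed

text \<open>The one-sided bound is used from either end of the shift, which puts both weights on the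
  right. A bound proportional to the weights lets the commutator be estimated by local
  norms.\<close>

lemma expw_diff_le:
  assumes "0 \<le> a"
  shows "\<bar>expw a (x + t) - expw a x\<bar> \<le> expw_lip a t * (expw a x + expw a (x + t))"
proof -
  have "expw_lip a (- t) = expw_lip a t" by (simp add: expw_lip_def)
  then have "expw a (x + t) - expw a x \<le> expw_lip a t * expw a (x + t)"
    using expw_diff_le_aux[OF assms, of "x + t" "- t"] by simp
  moreover have "0 \<le> expw_lip a t * expw a x" "0 \<le> expw_lip a t * expw a (x + t)"
    using assms by simp_all
  ultimately show ?thesis
    using expw_diff_le_aux[OF assms, of x t] unfolding distrib_left by linarith
qed

text \<open>Dominated convergence with majorant \<open>h\<close>. This is what makes the commutator
  small for small \<open>a\<close>.\<close>

lemma nn_integral_expw_lip_tendsto_0: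
  fixes h :: "'a::euclidean_space \<Rightarrow> ennreal"
  assumes [measurable]: "h \<in> borel_measurable borel" and fin: "(\<integral>\<^sup>+t. h t \<partial>lborel) < \<infinity>"
  shows "(\<lambda>n. \<integral>\<^sup>+t. h t * ennreal (expw_lip (1 / real (Suc n)) t) \<partial>lborel) \<longlonglongrightarrow> 0"
proof -
  have "(\<lambda>n. \<integral>\<^sup>+t. h t * ennreal (expw_lip (1 / real (Suc n)) t) \<partial>lborel)
      \<longlonglongrightarrow> (\<integral>\<^sup>+(t::'a). 0 \<partial>lborel)"
  proof (rule nn_integral_dominated_convergence[where w=h])
    show "AE t in lborel. h t * ennreal (expw_lip (1 / real (Suc n)) t) \<le> h t" for n
      using mult_left_mono[of "ennreal (expw_lip (1 / real (Suc n)) _)" 1 "h _"]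
      by (intro AE_I2) (simp add: ennreal_le_1)
    have "AE t in lborel. h t \<noteq> \<infinity>"
      using fin by (intro nn_integral_PInf_AE) auto
    then show "AE t in lborel. (\<lambda>n. h t * ennreal (expw_lip (1 / real (Suc n)) t)) \<longlonglongrightarrow> 0"
    proof (rule eventually_mono)
      fix t assume "h t \<noteq> \<infinity>"
      have "(\<lambda>n. expw_lip (1 / real (Suc n)) t) \<longlonglongrightarrow> min 1 (0 * l1 t)"
        unfolding expw_lip_def
        by (intro tendsto_intros LIMSEQ_inverse_real_of_nat[unfolded inverse_eq_divide])
      then have "(\<lambda>n. h t * ennreal (expw_lip (1 / real (Suc n)) t)) \<longlonglongrightarrow> h t * ennreal (min 1 (0 * l1 t))"
        using \<open>h t \<noteq> \<infinity>\<close> by (intro ennreal_tendsto_cmult tendsto_ennrealI) (auto simp: less_top)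
      then show "(\<lambda>n. h t * ennreal (expw_lip (1 / real (Suc n)) t)) \<longlonglongrightarrow> 0" by simp
    qed
  qed (use fin in auto)
  then show ?thesis by simp
qed

text \<open>Both sides are suprema of finite sums, the left one along the exhaustion by
  \<open>A n\<close>. The Wiener norm is an \<open>infsum\<close>, while Tonelli's theorem is
  applied to counting measure.\<close>

lemma nn_integral_count_space_le_infsum:
  fixes c :: "'i \<Rightarrow> ennreal"
  assumes "countable (UNIV :: 'i set)"
  shows "(\<integral>\<^sup>+k. c k \<partial>count_space UNIV) \<le> infsum c UNIV"
proof -
  define A where "A n = {k::'i. to_nat_on UNIV k < n}" for n
  have inj: "inj (to_nat_on (UNIV::'i set))" using assms by (rule inj_on_to_nat_on)
  have fin: "finite (A n)" for n
    unfolding A_def using finite_vimageI[OF finite_lessThan[of n] inj] by (simp add: vimage_def)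
  have eq: "c k = (SUP n. c k * indicator (A n) k)" for k
  proof (rule antisym)
    have "c k = c k * indicator (A (Suc (to_nat_on UNIV k))) k" by (simp add: A_def)
    also have "\<dots> \<le> (SUP n. c k * indicator (A n) k)" by (rule SUP_upper) simp
    finally show "c k \<le> (SUP n. c k * indicator (A n) k)" .
  qed (auto intro!: SUP_least simp: indicator_def)
  have "(\<integral>\<^sup>+k. c k \<partial>count_space UNIV) = (\<integral>\<^sup>+k. (SUP n. c k * indicator (A n) k) \<partial>count_space UNIV)"
    by (intro nn_integral_cong eq)
  also have "\<dots> = (SUP n. \<integral>\<^sup>+k. c k * indicator (A n) k \<partial>count_space UNIV)"
    by (rule nn_integral_monotone_convergence_SUP)
       (auto simp: incseq_def le_fun_def A_def indicator_def)
  also have "\<dots> = (SUP n. sum c (A n))"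
    by (subst nn_integral_count_space_indicator[symmetric]) (auto simp: nn_integral_count_space_finite fin)
  also have "\<dots> \<le> infsum c UNIV"
    using fin by (subst nonneg_infsum_complete) (auto intro!: SUP_least SUP_upper)
  finally show ?thesis .
qed

text \<open>The supremum \<open>c k\<close> over each unit cube is spread out by an exponential bump
  at the lattice point of the cube. Unlike the step function with values \<open>c k\<close>, the sum
  \<open>h\<close> varies slowly, in the sense of the last property.\<close>

lemma wiener_norm_majorant:
  fixes \<phi> :: "real^'d \<Rightarrow> ennreal"
  assumes "wiener_norm \<phi> < \<infinity>"
  obtains h :: "real^'d \<Rightarrow> ennreal" where
    "h \<in> borel_measurable borel" "(\<integral>\<^sup>+t. h t \<partial>lborel) < \<infinity>"
    "\<And>t. \<phi> t \<le> h t" "\<And>t s. h (t + s) \<le> ennreal (exp (l1 s)) * h t"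
proof -
  let ?Q = "{x::real^'d. \<forall>i. 0 \<le> x $ i \<and> x $ i < 1}"
  let ?v = "\<lambda>k::int^'d. (\<chi> i. of_int (k $ i)) :: real^'d"
  define c where "c k = (SUP x\<in>?Q. \<phi> (?v k + x))" for k
  \<comment> \<open>On the unit cube \<open>l1\<close> is at most the dimension, so this factor
    makes each bump at least \<open>1\<close> on its own cube.\<close>
  define E where "E = exp (real CARD('d))"
  define h where "h t = (\<integral>\<^sup>+k. c k * ennreal (E * expw 1 (t - ?v k)) \<partial>count_space UNIV)" for t
  have count: "countable (UNIV :: (int^'d) set)"
    using countable_vector[of "\<lambda>_::'d. UNIV :: int set"] by simp
  have sf: "sigma_finite_measure (count_space (UNIV :: (int^'d) set))"
    by (rule sigma_finite_measure_count_space_countable[OF count])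
  have csum: "(\<integral>\<^sup>+k. c k \<partial>count_space UNIV) < \<infinity>"
    using nn_integral_count_space_le_infsum[OF count, of c] assms
    by (simp add: wiener_norm_def c_def[abs_def] less_top le_less_trans)
  have meas_term[measurable]: "(\<lambda>t. c k * ennreal (E * expw 1 (t - ?v k))) \<in> borel_measurable borel" for k
    by measurable
  have 1: "h \<in> borel_measurable borel"
  proof -
    \<comment> \<open>Joint measurability may be checked for each \<open>k\<close> separately, the
      index set being countable.\<close>
    have "(\<lambda>(t, k). c k * ennreal (E * expw 1 (t - ?v k))) \<in> borel_measurable (borel \<Otimes>\<^sub>M count_space UNIV)"
      unfolding measurable_pair_swap_iff[of _ borel]
      by (rule measurable_pair_measure_countable1[OF count]) (simp only: prod.case meas_term)
    then show ?thesis
      unfolding h_def by (rule sigma_finite_measure.borel_measurable_nn_integral[OF sf])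
  qed
  have "(\<integral>\<^sup>+t. h t \<partial>lborel) = (\<integral>\<^sup>+k. (\<integral>\<^sup>+t. c k * ennreal (E * expw 1 (t - ?v k)) \<partial>lborel) \<partial>count_space UNIV)"
    unfolding h_def using count by (rule nn_integral_count_space_nn_integral) simp
  also have "\<dots> = (\<integral>\<^sup>+k. c k * (ennreal E * (\<integral>\<^sup>+(t::real^'d). ennreal (expw 1 t) \<partial>lborel)) \<partial>count_space UNIV)"
  proof (rule nn_integral_cong)
    fix k :: "int^'d"
    have "(\<integral>\<^sup>+t. c k * ennreal (E * expw 1 (t - ?v k)) \<partial>lborel)
        = c k * (ennreal E * (\<integral>\<^sup>+t. ennreal (expw 1 (t + - ?v k)) \<partial>lborel))"
      by (simp add: nn_integral_cmult ennreal_mult E_def)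
    also have "(\<integral>\<^sup>+t. ennreal (expw 1 (t + - ?v k)) \<partial>lborel) = (\<integral>\<^sup>+(t::real^'d). ennreal (expw 1 t) \<partial>lborel)"
      by (rule nn_integral_lborel_translate[where f="\<lambda>t. ennreal (expw 1 t)"]) simp
    finally show "(\<integral>\<^sup>+t. c k * ennreal (E * expw 1 (t - ?v k)) \<partial>lborel)
        = c k * (ennreal E * (\<integral>\<^sup>+(t::real^'d). ennreal (expw 1 t) \<partial>lborel))" .
  qed
  also have "\<dots> < \<infinity>"
    using csum nn_integral_expw_finite[where a=1 and 'a="real^'d"]
    by (simp add: nn_integral_multc ennreal_mult_less_top)
  finally have 2: "(\<integral>\<^sup>+t. h t \<partial>lborel) < \<infinity>" .
  have 3: "\<phi> t \<le> h t" for t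
  proof -
    define k :: "int^'d" where "k = (\<chi> i. \<lfloor>t $ i\<rfloor>)"
    have Q: "t - ?v k \<in> ?Q" by (auto simp: k_def) linarith
    have "\<bar>(t - ?v k) \<bullet> b\<bar> \<le> 1" if "b \<in> Basis" for b
    proof -
      obtain i where "b = axis i 1" using \<open>b \<in> Basis\<close> by (auto simp: Basis_vec_def)
      then have eq: "(t - ?v k) \<bullet> b = (t - ?v k) $ i" by (simp add: inner_axis)
      have "0 \<le> (t - ?v k) $ i" "(t - ?v k) $ i < 1" using Q by blast+
      then show ?thesis unfolding eq by (intro abs_leI) linarith+
    qed
    then have "l1 (t - ?v k) \<le> real CARD('d)"
      unfolding l1_def using sum_bounded_above[of Basis "\<lambda>b. \<bar>(t - ?v k) \<bullet> b\<bar>" 1] by simp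
    then have "1 \<le> E * expw 1 (t - ?v k)"
      by (simp add: E_def expw_def flip: exp_add)
    then have "\<phi> (?v k + (t - ?v k)) * 1 \<le> c k * ennreal (E * expw 1 (t - ?v k))"
      unfolding c_def using Q by (intro mult_mono SUP_upper) auto
    also have "\<dots> = (\<integral>\<^sup>+j. c j * ennreal (E * expw 1 (t - ?v j)) * indicator {k} j \<partial>count_space UNIV)"
      by (subst nn_integral_count_space_indicator[symmetric]) (auto simp: nn_integral_count_space_finite)
    also have "\<dots> \<le> h t"
      unfolding h_def by (intro nn_integral_mono) (auto simp: indicator_def)
    finally show ?thesis by simp
  qed
  have 4: "h (t + s) \<le> ennreal (exp (l1 s)) * h t" for t s
  proof -
    \<comment> \<open>Each bump obeys the shift bound by the triangle inequality, and the sum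
      inherits it.\<close>
    have "expw 1 (t + s - y) \<le> exp (l1 s) * expw 1 (t - y)" for y
    proof -
      have "l1 (t - y) \<le> l1 (t + s - y) + l1 s"
        using l1_triangle[of "t + s - y" "- s"] by (simp add: algebra_simps)
      then show ?thesis by (simp add: expw_def flip: exp_add)
    qed
    then have "h (t + s) \<le> (\<integral>\<^sup>+k. ennreal (exp (l1 s)) * (c k * ennreal (E * expw 1 (t - ?v k))) \<partial>count_space UNIV)"
      unfolding h_def
    proof (intro nn_integral_mono)
      fix k
      have "E * expw 1 (t + s - ?v k) \<le> exp (l1 s) * (E * expw 1 (t - ?v k))"
        using \<open>expw 1 (t + s - ?v k) \<le> exp (l1 s) * expw 1 (t - ?v k)\<close>
        by (simp add: E_def mult.left_commute)
      then have "c k * ennreal (E * expw 1 (t + s - ?v k)) \<le> c k * ennreal (exp (l1 s) * (E * expw 1 (t - ?v k)))"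
        by (intro mult_left_mono ennreal_leI) auto
      then show "c k * ennreal (E * expw 1 (t + s - ?v k)) \<le> ennreal (exp (l1 s)) * (c k * ennreal (E * expw 1 (t - ?v k)))"
        by (simp add: ennreal_mult E_def mult_ac)
    qed
    also have "\<dots> = ennreal (exp (l1 s)) * h t"
      unfolding h_def by (rule nn_integral_cmult) simp
    finally show ?thesis .
  qed
  show thesis using that[of h] 1 2 3 4 by blast
qed

text \<open>The Wiener norm dominates pointwise values, so the hypothesis is a uniform Hoelder
  estimate for \<open>K\<close>. Continuity serves to make \<open>K\<close> jointly
  measurable.\<close>

lemma kernel_continuous:
  fixes K :: "real^'d \<Rightarrow> real^'d \<Rightarrow> complex"
  assumes "0 < \<alpha>" "0 < D"
    and *: "\<And>\<delta>. 0 < \<delta> \<Longrightarrow> \<delta> < 1 \<Longrightarrow>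
           wiener_norm (\<lambda>x. SUP y. modulus_of_continuity \<delta> K y (x + y)) \<le> ennreal (D * \<delta> powr \<alpha>)"
  shows "continuous_on UNIV (\<lambda>(x, y). K x y)"
proof -
  let ?Q = "{x::real^'d. \<forall>i. 0 \<le> x $ i \<and> x $ i < 1}"
  let ?v = "\<lambda>k::int^'d. (\<chi> i. of_int (k $ i)) :: real^'d"
  \<comment> \<open>The value at \<open>t\<close> is bounded by the term of the cube containing
    \<open>t\<close>, a partial sum with one index.\<close>
  have le_wiener: "\<phi> t \<le> wiener_norm \<phi>" for \<phi> :: "real^'d \<Rightarrow> ennreal" and t
  proof -
    define k :: "int^'d" where "k = (\<chi> i. \<lfloor>t $ i\<rfloor>)"
    have Q: "t - ?v k \<in> ?Q" by (auto simp: k_def) linarith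
    have "\<phi> (?v k + (t - ?v k)) \<le> (SUP x\<in>?Q. \<phi> (?v k + x))"
      using Q by (intro SUP_upper) auto
    also have "\<dots> = (\<Sum>k\<in>{k}. SUP x\<in>?Q. \<phi> (?v k + x))" by simp
    also have "\<dots> \<le> wiener_norm \<phi>"
      unfolding wiener_norm_def by (subst nonneg_infsum_complete) (auto intro!: SUP_upper2[of "{k}"])
    finally show ?thesis by simp
  qed
  have bound: "norm (K (x + x') (y + y') - K x y) \<le> D * \<delta> powr \<alpha>"
    if "0 < \<delta>" "\<delta> < 1" "norm (x', y') \<le> \<delta>" for x y x' y' \<delta>
  proof -
    have "ennreal (norm (K (x + x') (y + y') - K x y)) \<le> modulus_of_continuity \<delta> K x y"
      unfolding modulus_of_continuity_def using that by (intro SUP_upper2[of "(x', y')"]) auto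
    \<comment> \<open>The point \<open>(x, y)\<close> lies on the diagonal with offset
      \<open>y - x\<close>, at the parameter \<open>z = x\<close>.\<close>
    also have "\<dots> \<le> (SUP z. modulus_of_continuity \<delta> K z ((y - x) + z))"
      by (rule SUP_upper2[of x]) auto
    also have "\<dots> \<le> ennreal (D * \<delta> powr \<alpha>)"
      by (rule order_trans[OF le_wiener[of "\<lambda>w. SUP z. modulus_of_continuity \<delta> K z (w + z)"] *[OF that(1,2)]])
    finally show ?thesis using that \<open>0 < D\<close> by (simp add: ennreal_le_iff)
  qed
  have "((\<lambda>\<delta>. D * \<delta> powr \<alpha>) \<longlongrightarrow> D * 0 powr \<alpha>) (at_right 0)"
    using \<open>0 < \<alpha>\<close> by (intro tendsto_intros) (auto simp: eventually_at_filter)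
  then have lim: "((\<lambda>\<delta>. D * \<delta> powr \<alpha>) \<longlongrightarrow> 0) (at_right 0)" by simp
  show ?thesis
    unfolding continuous_on_iff
  proof (intro ballI allI impI)
    fix z :: "(real^'d) \<times> (real^'d)" and e :: real
    assume "0 < e"
    have "eventually (\<lambda>\<delta>. D * \<delta> powr \<alpha> < e) (at_right 0)"
      using lim \<open>0 < e\<close> by (rule order_tendstoD)
    moreover have "eventually (\<lambda>\<delta>::real. \<delta> < 1) (at_right 0)"
      unfolding eventually_at_right_field by (intro exI[of _ 1]) auto
    moreover have "eventually (\<lambda>\<delta>::real. 0 < \<delta>) (at_right 0)"
      by (rule eventually_at_right_less)
    ultimately have "eventually (\<lambda>\<delta>. D * \<delta> powr \<alpha> < e \<and> \<delta> < 1 \<and> 0 < \<delta>) (at_right 0)"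
      by eventually_elim simp
    from eventually_happens'[OF trivial_limit_at_right_real this]
    obtain \<delta> where \<delta>: "D * \<delta> powr \<alpha> < e" "\<delta> < 1" "0 < \<delta>" by blast
    show "\<exists>d>0. \<forall>w\<in>UNIV. dist w z < d \<longrightarrow>
        dist (case w of (x, y) \<Rightarrow> K x y) (case z of (x, y) \<Rightarrow> K x y) < e"
    proof (intro exI[of _ \<delta>] conjI ballI impI \<delta>)
      fix w assume w: "dist w z < \<delta>"
      have "norm (K (fst z + (fst w - fst z)) (snd z + (snd w - snd z)) - K (fst z) (snd z)) \<le> D * \<delta> powr \<alpha>"
        using w \<delta> by (intro bound) (auto simp: dist_norm minus_prod_def)
      then show "dist (case w of (x, y) \<Rightarrow> K x y) (case z of (x, y) \<Rightarrow> K x y) < e"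
        using \<delta> by (simp add: dist_norm split_beta)
    qed
  qed
qed

section \<open>Kernels dominated by a convolution\<close>

abbreviation (input) enorm :: "('a \<Rightarrow> complex) \<Rightarrow> 'a \<Rightarrow> ennreal" where
  "enorm f \<equiv> (\<lambda>x. ennreal (norm (f x)))"

text \<open>Applied to the moduli of \<open>v\<close> and \<open>S v\<close>, this gives the
  functions \<open>\<alpha>\<close> and \<open>\<beta>\<close> of the outline.\<close>

definition local_norm :: "ennreal \<Rightarrow> real \<Rightarrow> ('a::euclidean_space \<Rightarrow> ennreal) \<Rightarrow> 'a \<Rightarrow> ennreal" where
  "local_norm p a F z = eLp p (\<lambda>x. ennreal (expw a (x - z)) * F x)"

definition expw_avg :: "('a::euclidean_space \<Rightarrow> ennreal) \<Rightarrow> 'a \<Rightarrow> ennreal" where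
  "expw_avg F x = (\<integral>\<^sup>+s. ennreal (expw 1 s) * F (x + s) \<partial>lborel)"

lemma local_norm_measurable[measurable]:
  assumes "1 \<le> p" and [measurable]: "F \<in> borel_measurable borel"
  shows "local_norm p a F \<in> borel_measurable borel"
  unfolding local_norm_def[abs_def] using assms(1) by (intro eLp_measurable) measurable

lemma expw_avg_measurable[measurable]:
  assumes [measurable]: "F \<in> borel_measurable borel"
  shows "expw_avg F \<in> borel_measurable borel"
  unfolding expw_avg_def[abs_def] by measurable

text \<open>Since \<open>2 * a \<le> 1\<close>, the averaging weight splits into two weights of rate
  \<open>a\<close>; the condition \<open>a \<le> 1 / 2\<close> in what follows comes from
  here.\<close>

lemma expw_1_le:
  assumes "0 \<le> a" "a \<le> 1 / 2"
  shows "ennreal (expw 1 x) \<le> ennreal (expw a x) * ennreal (expw a x)"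
  using expw_antimono[of "a + a" 1 x] assms
  by (simp add: expw_mult flip: ennreal_mult)

lemma expw_avg_eq:
  assumes [measurable]: "F \<in> borel_measurable borel"
  shows "expw_avg F x = (\<integral>\<^sup>+y. ennreal (expw 1 (y - x)) * F y \<partial>lborel)"
  using nn_integral_lborel_translate[of "\<lambda>y. ennreal (expw 1 (y - x)) * F y" x]
  by (simp add: expw_avg_def add.commute)

text \<open>One factor of the averaging weight serves in the Hoelder-type bound, the other is the
  weight of the local norm.\<close>

lemma expw_avg_le_local_norm:
  fixes F :: "'a::euclidean_space \<Rightarrow> ennreal"
  assumes p: "1 \<le> p" and a: "0 < a" "a \<le> 1 / 2" and [measurable]: "F \<in> borel_measurable borel"
  shows "expw_avg F x \<le> ((\<integral>\<^sup>+(t::'a). ennreal (expw a t) \<partial>lborel) + 1) * local_norm p a F x"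
proof -
  have W: "(\<integral>\<^sup>+y. ennreal (expw a (y - x)) \<partial>lborel) = (\<integral>\<^sup>+(t::'a). ennreal (expw a t) \<partial>lborel)"
    using nn_integral_lborel_translate[of "\<lambda>t::'a. ennreal (expw a t)" "- x"] by simp
  have "expw_avg F x \<le> (\<integral>\<^sup>+y. ennreal (expw a (y - x)) * (ennreal (expw a (y - x)) * F y) \<partial>lborel)"
    unfolding expw_avg_eq[OF assms(4)] mult.assoc[symmetric]
    using a by (intro nn_integral_mono mult_right_mono expw_1_le) auto
  also have "\<dots> \<le> ((\<integral>\<^sup>+y. ennreal (expw a (y - x)) \<partial>lborel) + 1) * local_norm p a F x"
    unfolding local_norm_def using p a nn_integral_expw_finite[OF a(1), where 'a='a]
    by (intro nn_integral_weighted_le_eLp) (auto simp: W ennreal_le_1)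
  finally show ?thesis by (simp only: W)
qed

text \<open>Averaging improves local integrability: only a weighted \<open>L\<^sup>1\<close>-mean of
  \<open>F\<close> remains. One factor of the averaging weight moves the cutoff from
  \<open>x\<close> to \<open>y\<close> by the triangle inequality; the other is a function of
  \<open>x\<close> whose \<open>p\<close>-norm does not depend on \<open>y\<close>, and Minkowski's
  inequality applies.\<close>

lemma local_norm_expw_avg_le:
  fixes F :: "'a::euclidean_space \<Rightarrow> ennreal"
  assumes p: "1 \<le> p" and a: "0 < a" "a \<le> 1 / 2" and [measurable]: "F \<in> borel_measurable borel"
    and fin: "\<And>x. F x < \<infinity>"
  shows "local_norm p a (expw_avg F) z
    \<le> eLp p (\<lambda>x::'a. ennreal (expw a x)) * (\<integral>\<^sup>+s. ennreal (expw a s) * F (z + s) \<partial>lborel)"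
proof -
  have le: "ennreal (expw a (x - z)) * ennreal (expw 1 (y - x)) \<le> ennreal (expw a (y - z)) * ennreal (expw a (y - x))"
    for x y
  proof -
    have "expw a (x - z) * expw a (y - x) \<le> expw a (y - z)"
      using expw_add_ge[of a "x - z" "y - x"] a by simp
    then have "ennreal (expw a (x - z)) * ennreal (expw a (y - x)) \<le> ennreal (expw a (y - z))"
      by (simp flip: ennreal_mult)
    then have "ennreal (expw a (x - z)) * ennreal (expw a (y - x)) * ennreal (expw a (y - x))
        \<le> ennreal (expw a (y - z)) * ennreal (expw a (y - x))"
      by (rule mult_right_mono) simp
    moreover have "ennreal (expw a (x - z)) * ennreal (expw 1 (y - x))
        \<le> ennreal (expw a (x - z)) * (ennreal (expw a (y - x)) * ennreal (expw a (y - x)))"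
      using a by (intro mult_left_mono expw_1_le) auto
    ultimately show ?thesis by (simp add: mult.assoc)
  qed
  have "ennreal (expw a (x - z)) * expw_avg F x
      \<le> (\<integral>\<^sup>+y. (ennreal (expw a (y - z)) * F y) * ennreal (expw a (y - x)) \<partial>lborel)" for x
  proof -
    have "ennreal (expw a (x - z)) * expw_avg F x
        = (\<integral>\<^sup>+y. ennreal (expw a (x - z)) * (ennreal (expw 1 (y - x)) * F y) \<partial>lborel)"
      by (simp add: expw_avg_eq nn_integral_cmult)
    also have "\<dots> \<le> (\<integral>\<^sup>+y. (ennreal (expw a (y - z)) * F y) * ennreal (expw a (y - x)) \<partial>lborel)"
    proof (rule nn_integral_mono)
      fix y
      show "ennreal (expw a (x - z)) * (ennreal (expw 1 (y - x)) * F y)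
          \<le> (ennreal (expw a (y - z)) * F y) * ennreal (expw a (y - x))"
        using mult_right_mono[OF le[of x y], of "F y"] by (simp add: mult_ac)
    qed
    finally show ?thesis .
  qed
  then have "local_norm p a (expw_avg F) z
      \<le> eLp p (\<lambda>x. \<integral>\<^sup>+y. (ennreal (expw a (y - z)) * F y) * ennreal (expw a (y - x)) \<partial>lborel)"
    unfolding local_norm_def by (intro eLp_mono) auto
  also have "\<dots> \<le> (\<integral>\<^sup>+y. (ennreal (expw a (y - z)) * F y) * eLp p (\<lambda>x. ennreal (expw a (y - x))) \<partial>lborel)"
    using p fin by (intro eLp_nn_integral_mult_le) (auto simp: ennreal_mult_less_top)
  also have "\<dots> = (\<integral>\<^sup>+y. (ennreal (expw a (y - z)) * F y) \<partial>lborel) * eLp p (\<lambda>x::'a. ennreal (expw a x))"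
    using p by (simp add: eLp_reflect[where F="\<lambda>x. ennreal (expw a x)"] nn_integral_multc)
  also have "(\<integral>\<^sup>+y. (ennreal (expw a (y - z)) * F y) \<partial>lborel) = (\<integral>\<^sup>+s. ennreal (expw a s) * F (z + s) \<partial>lborel)"
    using nn_integral_lborel_translate[of "\<lambda>y. ennreal (expw a (y - z)) * F y" z]
    by (simp add: add.commute)
  finally show ?thesis by (simp add: mult.commute)
qed

text \<open>Separates the operator estimates from the amalgam conditions:
  \<open>wiener_norm_majorant\<close> supplies \<open>h\<close>, and
  \<open>kernel_continuous\<close> the measurability.\<close>

locale dominated_kernel =
  fixes K :: "real^'d \<Rightarrow> real^'d \<Rightarrow> complex" and h :: "real^'d \<Rightarrow> ennreal"
  assumes K_pair_measurable: "(\<lambda>(x, y). K x y) \<in> borel_measurable (borel \<Otimes>\<^sub>M borel)"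
    and h_measurable[measurable]: "h \<in> borel_measurable borel"
    and h_finite: "(\<integral>\<^sup>+t. h t \<partial>lborel) < \<infinity>"
    and K_le: "ennreal (norm (K x (x + t))) \<le> h t"
    and h_shift: "h (t + s) \<le> ennreal (exp (l1 s)) * h t"
begin

section \<open>Bounds for the integral operator by convolution with \<open>h\<close>\<close>

lemmas K_measurable[measurable (raw)] = measurable_Pair_compose_split[OF K_pair_measurable]

abbreviation T :: "(real^'d \<Rightarrow> complex) \<Rightarrow> real^'d \<Rightarrow> complex" where
  "T \<equiv> integral_operator K"

definition hconv :: "(real^'d \<Rightarrow> ennreal) \<Rightarrow> real^'d \<Rightarrow> ennreal" where
  "hconv F x = (\<integral>\<^sup>+t. h t * F (x + t) \<partial>lborel)"

lemma hconv_measurable[measurable]: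
  assumes [measurable]: "F \<in> borel_measurable borel"
  shows "hconv F \<in> borel_measurable borel"
  unfolding hconv_def[abs_def] by measurable

lemma h_AE_finite: "AE t in lborel. h t < \<infinity>"
  using h_finite nn_integral_PInf_AE[of h lborel] by (auto simp: less_top)

lemma eLp_hconv_le:
  assumes "1 \<le> q" "F \<in> borel_measurable borel"
  shows "eLp q (hconv F) \<le> (\<integral>\<^sup>+t. h t \<partial>lborel) * eLp q F"
  unfolding hconv_def[abs_def] using assms h_finite by (intro eLp_convolution) auto

lemma kernel_le_hconv:
  assumes [measurable]: "G \<in> borel_measurable borel"
  shows "(\<integral>\<^sup>+y. ennreal (norm (K x y)) * G y \<partial>lborel) \<le> hconv G x"
proof -
  have "(\<integral>\<^sup>+y. ennreal (norm (K x y)) * G y \<partial>lborel) = (\<integral>\<^sup>+t. ennreal (norm (K x (x + t))) * G (x + t) \<partial>lborel)"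
    using nn_integral_lborel_translate[of "\<lambda>y. ennreal (norm (K x y)) * G y" x]
    by (simp add: add.commute)
  also have "\<dots> \<le> hconv G x"
    unfolding hconv_def by (intro nn_integral_mono mult_right_mono K_le) simp
  finally show ?thesis .
qed

lemma T_measurable[measurable]:
  assumes [measurable]: "f \<in> borel_measurable borel"
  shows "T f \<in> borel_measurable borel"
  unfolding integral_operator_def by measurable

lemma T_le_kernel:
  assumes [measurable]: "f \<in> borel_measurable borel"
  shows "enorm (T f) x \<le> (\<integral>\<^sup>+y. ennreal (norm (K x y)) * enorm f y \<partial>lborel)"
proof (cases "integrable lborel (\<lambda>y. K x y * f y)")
  case True
  show ?thesis
    using integral_norm_bound_ennreal[OF True]
    by (simp add: integral_operator_def norm_mult ennreal_mult)
\<comment> \<open>Where the integral does not exist its value is \<open>0\<close> by convention, and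
  the bound is trivial.\<close>
qed (simp add: integral_operator_def not_integrable_integral_eq)

lemma T_le:
  assumes [measurable]: "f \<in> borel_measurable borel"
  shows "enorm (T f) x \<le> hconv (enorm f) x"
  using T_le_kernel[OF assms] kernel_le_hconv[of "enorm f" x] by (rule order_trans) simp

lemma eLp_T_le:
  assumes "1 \<le> q" and [measurable]: "f \<in> borel_measurable borel"
  shows "eLp q (enorm (T f)) \<le> (\<integral>\<^sup>+t. h t \<partial>lborel) * eLp q (enorm f)"
proof -
  have "eLp q (enorm (T f)) \<le> eLp q (hconv (enorm f))"
    by (intro eLp_mono T_le) measurable
  also have "\<dots> \<le> (\<integral>\<^sup>+t. h t \<partial>lborel) * eLp q (enorm f)"
    using assms by (intro eLp_hconv_le) measurable
  finally show ?thesis .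
qed

lemma eLp_T_finite:
  assumes "1 \<le> q" "f \<in> borel_measurable borel" "eLp q (enorm f) < \<infinity>"
  shows "eLp q (enorm (T f)) < \<infinity>"
  using eLp_T_le[OF assms(1,2)] assms(3) h_finite by (auto simp: ennreal_mult_less_top intro: le_less_trans)

text \<open>A finite \<open>q\<close>-norm makes \<open>hconv (enorm f)\<close> finite almost
  everywhere, and this function dominates the integral of the modulus. Integrability is what permits
  splitting \<open>T\<close> over sums.\<close>

lemma AE_integrable:
  assumes "1 \<le> q" and [measurable]: "f \<in> borel_measurable borel" and "eLp q (enorm f) < \<infinity>"
  shows "AE x in lborel. integrable lborel (\<lambda>y. K x y * f y)"
proof -
  have "eLp q (hconv (enorm f)) < \<infinity>"
    using eLp_hconv_le[of q "enorm f"] assms h_finite by (auto simp: ennreal_mult_less_top intro: le_less_trans)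
  then have "AE x in lborel. hconv (enorm f) x < \<infinity>"
    using assms by (intro eLp_AE_finite[of q]) auto
  then show ?thesis
  proof (rule eventually_mono)
    fix x assume "hconv (enorm f) x < \<infinity>"
    then have "(\<integral>\<^sup>+y. ennreal (norm (K x y)) * enorm f y \<partial>lborel) < \<infinity>"
      using kernel_le_hconv[of "enorm f" x] by (auto intro: le_less_trans)
    then show "integrable lborel (\<lambda>y. K x y * f y)"
      by (intro integrableI_bounded) (auto simp: norm_mult ennreal_mult)
  qed
qed

lemma T_add:
  assumes "integrable lborel (\<lambda>y. K x y * f y)" "integrable lborel (\<lambda>y. K x y * g y)"
  shows "T (\<lambda>t. f t + g t) x = T f x + T g x"
  using assms by (simp add: integral_operator_def distrib_left)

lemma T_cmult: "T (\<lambda>t. c * f t) x = c * T f x"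
  by (simp add: integral_operator_def mult.left_commute)

lemma T_cong_AE:
  assumes [measurable]: "f \<in> borel_measurable borel" "g \<in> borel_measurable borel"
    and "AE x in lborel. f x = g x"
  shows "T f x = T g x"
  unfolding integral_operator_def
  using assms(3) by (intro integral_cong_AE) (auto elim: eventually_mono)

text \<open>By \<open>h_shift\<close>, \<open>h\<close> is comparable to its own average against \<open>expw 1\<close>, so that a convolution
  with \<open>h\<close> may be preceded by a local averaging, which turns integrability into boundedness.\<close>

lemma hconv_le_hconv_expw_avg:
  obtains C where "C < \<infinity>"
    "\<And>F x. F \<in> borel_measurable borel \<Longrightarrow> hconv F x \<le> C * hconv (expw_avg F) x"
proof
  \<comment> \<open>The rate \<open>2\<close> exceeds by one the growth rate of \<open>h\<close>
    under shifts; the difference is the weight of \<open>expw_avg\<close>.\<close>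
  let ?I = "\<integral>\<^sup>+(s::real^'d). ennreal (expw 2 s) \<partial>lborel"
  have I: "0 < ?I" "?I < \<infinity>"
    using nn_integral_expw_pos nn_integral_expw_finite[of 2] by auto
  then show "inverse ?I < \<infinity>" by (simp add: less_top[symmetric] ennreal_inverse_eq_top_iff)
  fix F :: "real^'d \<Rightarrow> ennreal" and x :: "real^'d"
  assume [measurable]: "F \<in> borel_measurable borel"
  have le: "h t * ?I \<le> (\<integral>\<^sup>+s. h (t - s) * ennreal (expw 1 s) \<partial>lborel)" for t
  proof -
    have "h t * ennreal (expw 2 s) \<le> h (t - s) * ennreal (expw 1 s)" for s
    proof -
      have "h t * ennreal (expw 2 s) \<le> (ennreal (exp (l1 s)) * h (t - s)) * ennreal (expw 2 s)"
        using h_shift[of "t - s" s] by (intro mult_right_mono) auto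
      also have "\<dots> = h (t - s) * (ennreal (exp (l1 s)) * ennreal (expw 2 s))"
        by (simp add: mult_ac)
      also have "ennreal (exp (l1 s)) * ennreal (expw 2 s) = ennreal (expw 1 s)"
        by (simp add: expw_def flip: ennreal_mult exp_add)
      finally show ?thesis .
    qed
    then show ?thesis
      by (subst nn_integral_cmult[symmetric]) (auto intro: nn_integral_mono)
  qed
  have "?I * hconv F x = (\<integral>\<^sup>+t. (h t * ?I) * F (x + t) \<partial>lborel)"
    by (simp add: hconv_def mult_ac flip: nn_integral_cmult)
  also have "\<dots> \<le> (\<integral>\<^sup>+t. (\<integral>\<^sup>+s. h (t - s) * ennreal (expw 1 s) \<partial>lborel) * F (x + t) \<partial>lborel)"
    by (intro nn_integral_mono mult_right_mono le) simp
  also have "\<dots> = (\<integral>\<^sup>+t. (\<integral>\<^sup>+s. h (t - s) * ennreal (expw 1 s) * F (x + t) \<partial>lborel) \<partial>lborel)"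
    by (simp add: nn_integral_multc)
  also have "\<dots> = (\<integral>\<^sup>+s. (\<integral>\<^sup>+t. h (t - s) * ennreal (expw 1 s) * F (x + t) \<partial>lborel) \<partial>lborel)"
    by (rule lborel_pair.Fubini'[symmetric]) measurable
  also have "\<dots> = (\<integral>\<^sup>+s. (\<integral>\<^sup>+r. h r * ennreal (expw 1 s) * F (x + r + s) \<partial>lborel) \<partial>lborel)"
  proof (rule nn_integral_cong)
    fix s
    show "(\<integral>\<^sup>+t. h (t - s) * ennreal (expw 1 s) * F (x + t) \<partial>lborel)
        = (\<integral>\<^sup>+r. h r * ennreal (expw 1 s) * F (x + r + s) \<partial>lborel)"
      using nn_integral_lborel_translate[of "\<lambda>t. h (t - s) * ennreal (expw 1 s) * F (x + t)" s]
      by (simp add: add.assoc)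
  qed
  also have "\<dots> = (\<integral>\<^sup>+r. (\<integral>\<^sup>+s. h r * ennreal (expw 1 s) * F (x + r + s) \<partial>lborel) \<partial>lborel)"
    by (rule lborel_pair.Fubini') measurable
  also have "\<dots> = hconv (expw_avg F) x"
    by (simp add: hconv_def expw_avg_def mult.assoc nn_integral_cmult)
  finally have "inverse ?I * (?I * hconv F x) \<le> inverse ?I * hconv (expw_avg F) x"
    by (rule mult_left_mono) simp
  moreover have "inverse ?I * ?I = 1"
    using I by (simp add: mult.commute divide_ennreal_def[symmetric] ennreal_divide_self less_top)
  ultimately show "hconv F x \<le> inverse ?I * hconv (expw_avg F) x"
    by (simp add: mult.assoc[symmetric])
qed

text \<open>Minkowski's inequality in \<open>t\<close>; the shift of \<open>F\<close> by
  \<open>t\<close> is then absorbed by moving the centre of the weight to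
  \<open>z + t\<close>.\<close>

lemma local_norm_hconv_le:
  assumes p: "1 \<le> p" and [measurable]: "F \<in> borel_measurable borel"
  shows "local_norm p a (hconv F) z \<le> hconv (local_norm p a F) z"
proof -
  have "local_norm p a (hconv F) z = eLp p (\<lambda>x. \<integral>\<^sup>+t. h t * (ennreal (expw a (x - z)) * F (x + t)) \<partial>lborel)"
    unfolding local_norm_def hconv_def by (simp add: mult.left_commute flip: nn_integral_cmult)
  also have "\<dots> \<le> (\<integral>\<^sup>+t. h t * eLp p (\<lambda>x. ennreal (expw a (x - z)) * F (x + t)) \<partial>lborel)"
    using p h_AE_finite by (intro eLp_nn_integral_mult_le) auto
  also have "\<dots> = hconv (local_norm p a F) z"
    unfolding hconv_def
  proof (rule nn_integral_cong)
    fix t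
    show "h t * eLp p (\<lambda>x. ennreal (expw a (x - z)) * F (x + t)) = h t * local_norm p a F (z + t)"
      using eLp_translate[OF p, of "\<lambda>x. ennreal (expw a (x - (z + t))) * F x" t]
      by (simp add: local_norm_def)
  qed
  finally show ?thesis .
qed

text \<open>The smoothing step from global \<open>q\<close>-norms to local \<open>p\<close>-norms,
  with \<open>p\<close> and \<open>q\<close> unrelated: insert an average, move \<open>hconv\<close>
  outside the local norm, and let the average absorb the exponent \<open>p\<close>. Two convolution
  bounds in \<open>L\<^sup>q\<close> remain.\<close>

lemma eLp_local_norm_hconv_le:
  assumes p: "1 \<le> p" and q: "1 \<le> q" and a: "0 < a" "a \<le> 1 / 2"
  obtains C where "C < \<infinity>"
    "\<And>F. F \<in> borel_measurable borel \<Longrightarrow> (\<And>x. F x < \<infinity>) \<Longrightarrow>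
       eLp q (local_norm p a (hconv F)) \<le> C * eLp q F"
proof -
  obtain C where C: "C < \<infinity>"
      "\<And>F x. F \<in> borel_measurable borel \<Longrightarrow> hconv F x \<le> C * hconv (expw_avg F) x"
    using hconv_le_hconv_expw_avg by blast
  let ?W = "\<integral>\<^sup>+(s::real^'d). ennreal (expw a s) \<partial>lborel"
  let ?P = "eLp p (\<lambda>x::real^'d. ennreal (expw a x))"
  let ?H = "\<integral>\<^sup>+t. h t \<partial>lborel"
  have W: "?W < \<infinity>" by (rule nn_integral_expw_finite[OF a(1)])
  have P: "?P < \<infinity>" using p a W by (intro eLp_weight_finite) (auto simp: ennreal_le_1)
  show thesis
  proof (rule that)
    show "C * (?H * (?P * ?W)) < \<infinity>"
      using C W P h_finite by (simp add: ennreal_mult_less_top)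
    fix F :: "real^'d \<Rightarrow> ennreal"
    assume [measurable]: "F \<in> borel_measurable borel" and fin: "\<And>x. F x < \<infinity>"
    have "local_norm p a (hconv F) z \<le> C * hconv (local_norm p a (expw_avg F)) z" for z
    proof -
      have "local_norm p a (hconv F) z \<le> eLp p (\<lambda>x. C * (ennreal (expw a (x - z)) * hconv (expw_avg F) x))"
        unfolding local_norm_def
      proof (rule eLp_mono)
        fix x
        show "ennreal (expw a (x - z)) * hconv F x \<le> C * (ennreal (expw a (x - z)) * hconv (expw_avg F) x)"
          using mult_left_mono[OF C(2)[of F x], of "ennreal (expw a (x - z))"]
          by (simp add: mult_ac)
      qed measurable
      also have "\<dots> \<le> C * local_norm p a (hconv (expw_avg F)) z"
        unfolding local_norm_def using p C by (intro eLp_cmult) auto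
      also have "\<dots> \<le> C * hconv (local_norm p a (expw_avg F)) z"
        using p by (intro mult_left_mono local_norm_hconv_le) auto
      finally show ?thesis .
    qed
    then have "eLp q (local_norm p a (hconv F)) \<le> eLp q (\<lambda>z. C * hconv (local_norm p a (expw_avg F)) z)"
      using p by (intro eLp_mono) auto
    also have "\<dots> \<le> C * eLp q (hconv (local_norm p a (expw_avg F)))"
      using p q C by (intro eLp_cmult) auto
    also have "\<dots> \<le> C * (?H * eLp q (local_norm p a (expw_avg F)))"
      using p q by (intro mult_left_mono eLp_hconv_le) auto
    also have "eLp q (local_norm p a (expw_avg F))
        \<le> eLp q (\<lambda>z. ?P * (\<integral>\<^sup>+s. ennreal (expw a s) * F (z + s) \<partial>lborel))"
      using p a fin by (intro eLp_mono local_norm_expw_avg_le) auto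
    also have "\<dots> \<le> ?P * eLp q (\<lambda>z. \<integral>\<^sup>+s. ennreal (expw a s) * F (z + s) \<partial>lborel)"
      using q P by (intro eLp_cmult) auto
    also have "eLp q (\<lambda>z. \<integral>\<^sup>+s. ennreal (expw a s) * F (z + s) \<partial>lborel) \<le> ?W * eLp q F"
      using q W by (intro eLp_convolution) auto
    finally show "eLp q (local_norm p a (hconv F)) \<le> C * (?H * (?P * ?W)) * eLp q F"
      by (simp add: mult_left_mono mult.assoc)
  qed
qed

text \<open>The way back: once an average is inserted, its values are bounded pointwise by local
  norms of \<open>F\<close>, and only the \<open>q\<close>-norm in the centre remains.\<close>

lemma eLp_hconv_le_local_norm:
  assumes p: "1 \<le> p" and q: "1 \<le> q" and a: "0 < a" "a \<le> 1 / 2"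
  obtains C where "C < \<infinity>"
    "\<And>F. F \<in> borel_measurable borel \<Longrightarrow> eLp q (hconv F) \<le> C * eLp q (local_norm p a F)"
proof -
  obtain C where C: "C < \<infinity>"
      "\<And>F x. F \<in> borel_measurable borel \<Longrightarrow> hconv F x \<le> C * hconv (expw_avg F) x"
    using hconv_le_hconv_expw_avg by blast
  let ?W = "(\<integral>\<^sup>+(s::real^'d). ennreal (expw a s) \<partial>lborel) + 1"
  let ?H = "\<integral>\<^sup>+t. h t \<partial>lborel"
  have W: "?W < \<infinity>" using nn_integral_expw_finite[OF a(1), where 'a="real^'d"] by simp
  show thesis
  proof (rule that)
    show "C * (?H * ?W) < \<infinity>"
      using C W h_finite by (simp add: ennreal_mult_less_top)
    fix F :: "real^'d \<Rightarrow> ennreal"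
    assume [measurable]: "F \<in> borel_measurable borel"
    have "eLp q (hconv F) \<le> eLp q (\<lambda>x. C * hconv (expw_avg F) x)"
      using C by (intro eLp_mono) auto
    also have "\<dots> \<le> C * eLp q (hconv (expw_avg F))"
      using q C by (intro eLp_cmult) auto
    also have "\<dots> \<le> C * (?H * eLp q (expw_avg F))"
      using q by (intro mult_left_mono eLp_hconv_le) auto
    also have "eLp q (expw_avg F) \<le> eLp q (\<lambda>x. ?W * local_norm p a F x)"
      using p a by (intro eLp_mono expw_avg_le_local_norm) auto
    also have "\<dots> \<le> ?W * eLp q (local_norm p a F)"
      using p q W by (intro eLp_cmult) auto
    finally show "eLp q (hconv F) \<le> C * (?H * ?W) * eLp q (local_norm p a F)"
      by (simp add: mult_left_mono mult.assoc)
  qed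
qed

text \<open>Equals \<open>T (\<psi>\<^sub>z f) - \<psi>\<^sub>z T f\<close> at points where both
  integrals exist. Written as a single integral, it is bounded by \<open>T_le\<close>
  directly.\<close>

definition commutator :: "real \<Rightarrow> (real^'d \<Rightarrow> complex) \<Rightarrow> real^'d \<Rightarrow> real^'d \<Rightarrow> complex" where
  "commutator a f z x = T (\<lambda>y. complex_of_real (expw a (y - z) - expw a (x - z)) * f y) x"

lemma commutator_measurable[measurable]:
  assumes [measurable]: "f \<in> borel_measurable borel"
  shows "commutator a f z \<in> borel_measurable borel"
  unfolding commutator_def[abs_def] integral_operator_def by measurable

text \<open>By \<open>expw_diff_le\<close> a shift by \<open>t\<close> costs
  \<open>expw_lip a t\<close> times the weights at both ends. The weight at \<open>x + t\<close>
  moves along with \<open>f\<close> and gives \<open>\<alpha> z\<close>; the weight at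
  \<open>x\<close> gives the centre \<open>z + t\<close>.\<close>

lemma eLp_commutator_le:
  assumes p: "1 \<le> p" and a: "0 \<le> a" and [measurable]: "f \<in> borel_measurable borel"
  defines "\<alpha> \<equiv> local_norm p a (enorm f)"
  shows "eLp p (enorm (commutator a f z))
    \<le> (\<integral>\<^sup>+t. (h t * ennreal (expw_lip a t)) * (\<alpha> z + \<alpha> (z + t)) \<partial>lborel)"
proof -
  let ?G = "\<lambda>x t. ennreal (expw a (x - z)) * enorm f (x + t) + ennreal (expw a (x + t - z)) * enorm f (x + t)"
  have "enorm (commutator a f z) x \<le> (\<integral>\<^sup>+t. (h t * ennreal (expw_lip a t)) * ?G x t \<partial>lborel)" for x
  proof -
    let ?g = "\<lambda>y. complex_of_real (expw a (y - z) - expw a (x - z)) * f y"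
    have "enorm (commutator a f z) x \<le> hconv (enorm ?g) x"
      unfolding commutator_def by (rule T_le) measurable
    also have "\<dots> \<le> (\<integral>\<^sup>+t. (h t * ennreal (expw_lip a t)) * ?G x t \<partial>lborel)"
      unfolding hconv_def mult.assoc
    proof (intro nn_integral_mono mult_left_mono)
      fix t
      have "norm (?g (x + t)) = \<bar>expw a ((x - z) + t) - expw a (x - z)\<bar> * norm (f (x + t))"
        by (simp add: norm_mult algebra_simps flip: of_real_diff)
      also have "\<dots> \<le> (expw_lip a t * (expw a (x - z) + expw a ((x - z) + t))) * norm (f (x + t))"
        using a by (intro mult_right_mono expw_diff_le) auto
      finally have "ennreal (norm (?g (x + t))) \<le> ennreal (expw_lip a t * ((expw a (x - z) + expw a (x + t - z)) * norm (f (x + t))))"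
        by (intro ennreal_leI) (simp add: algebra_simps)
      also have "\<dots> = ennreal (expw_lip a t) * ?G x t"
        using a by (simp add: ennreal_mult distrib_right)
      finally show "ennreal (norm (?g (x + t))) \<le> ennreal (expw_lip a t) * ?G x t" .
    qed simp
    finally show ?thesis .
  qed
  then have "eLp p (enorm (commutator a f z))
      \<le> eLp p (\<lambda>x. \<integral>\<^sup>+t. (h t * ennreal (expw_lip a t)) * ?G x t \<partial>lborel)"
    by (intro eLp_mono) auto
  also have "\<dots> \<le> (\<integral>\<^sup>+t. (h t * ennreal (expw_lip a t)) * eLp p (\<lambda>x. ?G x t) \<partial>lborel)"
    using p h_AE_finite by (intro eLp_nn_integral_mult_le) (auto simp: ennreal_mult_less_top)
  also have "\<dots> \<le> (\<integral>\<^sup>+t. (h t * ennreal (expw_lip a t)) * (\<alpha> z + \<alpha> (z + t)) \<partial>lborel)"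
  proof (intro nn_integral_mono mult_left_mono)
    fix t
    have "eLp p (\<lambda>x. ?G x t) \<le> eLp p (\<lambda>x. ennreal (expw a (x - z)) * enorm f (x + t))
        + eLp p (\<lambda>x. ennreal (expw a (x + t - z)) * enorm f (x + t))"
      using p by (intro eLp_add) auto
    also have "eLp p (\<lambda>x. ennreal (expw a (x - z)) * enorm f (x + t)) = \<alpha> (z + t)"
      using eLp_translate[OF p, of "\<lambda>x. ennreal (expw a (x - (z + t))) * enorm f x" t]
      by (simp add: local_norm_def \<alpha>_def)
    also have "eLp p (\<lambda>x. ennreal (expw a (x + t - z)) * enorm f (x + t)) = \<alpha> z"
      using eLp_translate[OF p, of "\<lambda>x. ennreal (expw a (x - z)) * enorm f x" t]
      by (simp add: local_norm_def \<alpha>_def)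
    finally show "eLp p (\<lambda>x. ?G x t) \<le> \<alpha> z + \<alpha> (z + t)" by (simp add: add.commute)
  qed simp
  finally show ?thesis .
qed

text \<open>This is \<open>S \<phi> = \<psi>\<^sub>z S f + [T, \<psi>\<^sub>z] f\<close> at a point.
  The weights are at most \<open>1\<close>, so integrability at \<open>x\<close> passes from
  \<open>f\<close> to its cutoff \<open>\<phi>\<close>.\<close>

lemma cutoff_decomposition:
  fixes z :: "real^'d"
  assumes [measurable]: "f \<in> borel_measurable borel" and int: "integrable lborel (\<lambda>y. K x y * f y)"
    and a: "0 \<le> a"
  defines "\<phi> \<equiv> \<lambda>y. complex_of_real (expw a (y - z)) * f y"
  shows "\<phi> x + T \<phi> x = complex_of_real (expw a (x - z)) * (f x + T f x) + commutator a f z x"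
proof -
  have 1: "integrable lborel (\<lambda>y. K x y * \<phi> y)"
    unfolding \<phi>_def
    using int by (rule Bochner_Integration.integrable_bound)
      (use a in \<open>auto simp: norm_mult mult_left_le_one_le mult_left_le intro!: mult_left_mono\<close>)
  have "commutator a f z x = (LINT y|lborel. K x y * \<phi> y - complex_of_real (expw a (x - z)) * (K x y * f y))"
    by (simp add: commutator_def integral_operator_def \<phi>_def algebra_simps)
  also have "\<dots> = T \<phi> x - complex_of_real (expw a (x - z)) * T f x"
    using 1 int by (simp add: integral_operator_def)
  finally show ?thesis by (simp add: \<phi>_def algebra_simps)
qed

end

section \<open>Transfer of stability\<close>

text \<open>Finiteness of \<open>x\<close> permits subtracting \<open>e * x\<close>, and
  \<open>1 - e \<ge> 1 / 2\<close> gives the factor \<open>2\<close>.\<close>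

lemma ennreal_absorb:
  fixes x b :: ennreal
  assumes "x \<le> b + e * x" "e \<le> ennreal (1 / 2)" "x < \<infinity>"
  shows "x \<le> 2 * b"
proof (cases b)
  case (real r)
  obtain s where s: "x = ennreal s" "0 \<le> s" using assms by (cases x) auto
  obtain t where t: "e = ennreal t" "0 \<le> t"
    using assms(2) by (cases e) (auto simp: top_unique)
  then have "t \<le> 1 / 2" using assms(2) by (subst (asm) t(1), subst (asm) ennreal_le_iff) auto
  then have "t * s \<le> 1 / 2 * s" using s by (intro mult_right_mono) auto
  moreover have "s \<le> r + t * s"
    using assms(1) real s t by (simp flip: ennreal_mult ennreal_plus)
  ultimately have "ennreal s \<le> ennreal (2 * r)" by (intro ennreal_leI) simp
  then show ?thesis using real s by (simp add: ennreal_mult)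
qed (simp add: ennreal_mult_top)

context dominated_kernel
begin

text \<open>Passing to \<open>v = T f\<close> makes absorption possible: the smoothing of
  \<open>T\<close> guarantees beforehand that \<open>\<alpha>\<close> has finite
  \<open>q\<close>-norm. Stability for \<open>p\<close> is applied to cutoffs of \<open>v\<close>,
  whose \<open>p\<close>-norms are the values of \<open>\<alpha>\<close>.\<close>

lemma eLp_stable_transfer:
  assumes p: "1 \<le> p" and q: "1 \<le> q" and C: "C < \<infinity>"
    and stab: "\<And>f. f \<in> borel_measurable borel \<Longrightarrow> eLp p (enorm f) < \<infinity> \<Longrightarrow>
      eLp p (enorm f) \<le> C * eLp p (enorm (\<lambda>x. f x + T f x))"
  obtains C' where "C' < \<infinity>"
    "\<And>f. f \<in> borel_measurable borel \<Longrightarrow> eLp q (enorm f) < \<infinity> \<Longrightarrow>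
      eLp q (enorm f) \<le> C' * eLp q (enorm (\<lambda>x. f x + T f x))"
proof -
  define E where "E a = (\<integral>\<^sup>+t. h t * ennreal (expw_lip a t) \<partial>lborel)" for a
  have "(\<lambda>n. (2 * C) * E (1 / real (Suc n))) \<longlonglongrightarrow> (2 * C) * 0"
    unfolding E_def using C h_finite
    by (intro ennreal_tendsto_cmult nn_integral_expw_lip_tendsto_0) (auto simp: ennreal_mult_less_top)
  \<comment> \<open>The factor \<open>2\<close> accounts for the two terms \<open>\<alpha> z\<close>
    and \<open>\<alpha> (z + t)\<close> of the commutator bound.\<close>
  then have "eventually (\<lambda>n. (2 * C) * E (1 / real (Suc n)) < ennreal (1 / 2)) sequentially"
    by (rule order_tendstoD) (subst mult_zero_right, subst ennreal_less_zero_iff, simp)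
  then have "eventually (\<lambda>n. (2 * C) * E (1 / real (Suc n)) < ennreal (1 / 2) \<and> 1 \<le> n) sequentially"
    using eventually_ge_at_top[of 1] by eventually_elim simp
  then obtain n where n: "(2 * C) * E (1 / real (Suc n)) < ennreal (1 / 2)" "1 \<le> n"
    using eventually_happens' sequentially_bot by blast
  define a where "a = 1 / real (Suc n)"
  have a: "0 < a" "a \<le> 1 / 2"
    using n(2) by (auto simp: a_def field_simps)
  have small: "(2 * C) * E a \<le> ennreal (1 / 2)"
    unfolding a_def using n(1) by (rule less_imp_le)
  have E: "E a < \<infinity>"
  proof -
    have "E a \<le> (\<integral>\<^sup>+t. h t \<partial>lborel)"
      unfolding E_def using mult_left_mono[of "ennreal (expw_lip a _)" 1 "h _"]
      by (intro nn_integral_mono) (simp add: ennreal_le_1)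
    then show ?thesis using h_finite by (rule le_less_trans)
  qed
  obtain C1 where C1: "C1 < \<infinity>"
    "\<And>F. F \<in> borel_measurable borel \<Longrightarrow> (\<And>x. F x < \<infinity>) \<Longrightarrow>
       eLp q (local_norm p a (hconv F)) \<le> C1 * eLp q F"
    using eLp_local_norm_hconv_le[OF p q a] by blast
  obtain C2 where C2: "C2 < \<infinity>"
    "\<And>F. F \<in> borel_measurable borel \<Longrightarrow> eLp q (hconv F) \<le> C2 * eLp q (local_norm p a F)"
    using eLp_hconv_le_local_norm[OF p q a] by blast
  have local_T: "eLp q (local_norm p a (enorm (T f))) \<le> C1 * eLp q (enorm f)"
    if [measurable]: "f \<in> borel_measurable borel" for f
  proof -
    have "eLp q (local_norm p a (enorm (T f))) \<le> eLp q (local_norm p a (hconv (enorm f)))"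
      using p by (intro eLp_mono, simp, unfold local_norm_def, intro eLp_mono mult_left_mono T_le) auto
    also have "\<dots> \<le> C1 * eLp q (enorm f)" by (intro C1) auto
    finally show ?thesis .
  qed
  let ?H = "\<integral>\<^sup>+t. h t \<partial>lborel"
  have H: "?H < \<infinity>" by (rule h_finite)
  show thesis
  proof (rule that)
    show "1 + (?H + C2 * (2 * (C * C1))) < \<infinity>"
      using C C1 C2 H by (simp add: ennreal_mult_less_top)
    fix f :: "real^'d \<Rightarrow> complex"
    assume f[measurable]: "f \<in> borel_measurable borel" and ffin: "eLp q (enorm f) < \<infinity>"
    define g where "g x = f x + T f x" for x
    define v where "v = T f"
    have [measurable]: "v \<in> borel_measurable borel" "g \<in> borel_measurable borel"
      unfolding v_def g_def[abs_def] by measurable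
    have vfin: "eLp q (enorm v) < \<infinity>"
      unfolding v_def using q f ffin by (rule eLp_T_finite)
    have vT: "AE x in lborel. integrable lborel (\<lambda>y. K x y * v y)"
      using q vfin by (intro AE_integrable[of q]) auto
    \<comment> \<open>\<open>S\<close> commutes with \<open>T\<close>; the integrals may be split at
      almost every point.\<close>
    have Sv: "AE x in lborel. v x + T v x = T g x"
      using AE_integrable[OF q f ffin] vT
    proof eventually_elim
      case (elim x)
      then show ?case using T_add[of x f v] by (simp add: g_def[abs_def] v_def)
    qed
    define \<alpha> where "\<alpha> = local_norm p a (enorm v)"
    define \<beta> where "\<beta> = local_norm p a (enorm (T g))"
    have [measurable]: "\<alpha> \<in> borel_measurable borel" "\<beta> \<in> borel_measurable borel"
      unfolding \<alpha>_def \<beta>_def using p by auto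
    have \<alpha>fin: "eLp q \<alpha> < \<infinity>"
      using local_T[OF f] C1 ffin unfolding \<alpha>_def v_def
      by (auto simp: ennreal_mult_less_top intro: le_less_trans)
    let ?k = "\<lambda>t. h t * ennreal (expw_lip a t)"
    \<comment> \<open>For \<open>\<alpha> z < \<infinity>\<close> the cutoff at \<open>z\<close>
      belongs to \<open>L\<^sup>p\<close>, so stability applies. By \<open>\<alpha>fin\<close> this
      covers almost every \<open>z\<close>.\<close>
    have loc: "\<alpha> z \<le> C * (\<beta> z + (\<integral>\<^sup>+t. ?k t * (\<alpha> z + \<alpha> (z + t)) \<partial>lborel))" if z: "\<alpha> z < \<infinity>" for z
    proof -
      define \<phi> where "\<phi> y = complex_of_real (expw a (y - z)) * v y" for y
      have [measurable]: "\<phi> \<in> borel_measurable borel" unfolding \<phi>_def[abs_def] by measurable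
      have \<phi>: "enorm \<phi> x = ennreal (expw a (x - z)) * enorm v x" for x
        by (simp add: \<phi>_def norm_mult ennreal_mult)
      have \<phi>\<alpha>: "eLp p (enorm \<phi>) = \<alpha> z" by (simp add: \<phi> \<alpha>_def local_norm_def)
      then have "\<alpha> z \<le> C * eLp p (enorm (\<lambda>x. \<phi> x + T \<phi> x))"
        using stab[of \<phi>] z by simp
      also have "eLp p (enorm (\<lambda>x. \<phi> x + T \<phi> x))
          \<le> eLp p (\<lambda>x. ennreal (expw a (x - z)) * enorm (T g) x + enorm (commutator a v z) x)"
      proof (intro eLp_mono_AE)
        show "AE x in lborel. enorm (\<lambda>x. \<phi> x + T \<phi> x) x
            \<le> ennreal (expw a (x - z)) * enorm (T g) x + enorm (commutator a v z) x"
          using Sv vT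
        proof eventually_elim
          case (elim x)
          have "\<phi> x + T \<phi> x = complex_of_real (expw a (x - z)) * T g x + commutator a v z x"
            using cutoff_decomposition[of v x a z] elim a by (simp add: \<phi>_def[abs_def])
          then have "norm (\<phi> x + T \<phi> x) \<le> expw a (x - z) * norm (T g x) + norm (commutator a v z x)"
            using norm_triangle_ineq[of "complex_of_real (expw a (x - z)) * T g x"] by (simp add: norm_mult)
          then have "ennreal (norm (\<phi> x + T \<phi> x)) \<le> ennreal (expw a (x - z) * norm (T g x) + norm (commutator a v z x))"
            by (rule ennreal_leI)
          then show ?case by (simp add: ennreal_mult)
        qed
      qed measurable
      also have "\<dots> \<le> \<beta> z + eLp p (enorm (commutator a v z))"
        unfolding \<beta>_def local_norm_def using p by (intro eLp_add) auto
      also have "eLp p (enorm (commutator a v z)) \<le> (\<integral>\<^sup>+t. ?k t * (\<alpha> z + \<alpha> (z + t)) \<partial>lborel)"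
        unfolding \<alpha>_def using p a by (intro eLp_commutator_le) auto
      finally show ?thesis by (simp add: mult_left_mono add_left_mono)
    qed
    have split: "(\<integral>\<^sup>+t. ?k t * (\<alpha> z + \<alpha> (z + t)) \<partial>lborel)
        = E a * \<alpha> z + (\<integral>\<^sup>+t. ?k t * \<alpha> (z + t) \<partial>lborel)" for z
      by (simp add: distrib_left nn_integral_add nn_integral_multc E_def)
    \<comment> \<open>In the \<open>q\<close>-norm over \<open>z\<close>, both commutator terms
      contribute \<open>E a\<close> times the norm of \<open>\<alpha>\<close>, the second one by
      convolution.\<close>
    have "eLp q \<alpha> \<le> eLp q (\<lambda>z. C * (\<beta> z + (E a * \<alpha> z + (\<integral>\<^sup>+t. ?k t * \<alpha> (z + t) \<partial>lborel))))"
    proof (intro eLp_mono_AE)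
      show "AE z in lborel. \<alpha> z \<le> C * (\<beta> z + (E a * \<alpha> z + (\<integral>\<^sup>+t. ?k t * \<alpha> (z + t) \<partial>lborel)))"
        using eLp_AE_finite[OF q \<alpha>fin] unfolding split[symmetric]
        by (auto elim!: eventually_mono intro: loc)
    qed measurable
    also have "\<dots> \<le> C * eLp q (\<lambda>z. \<beta> z + (E a * \<alpha> z + (\<integral>\<^sup>+t. ?k t * \<alpha> (z + t) \<partial>lborel)))"
      using q C by (intro eLp_cmult) auto
    also have "eLp q (\<lambda>z. \<beta> z + (E a * \<alpha> z + (\<integral>\<^sup>+t. ?k t * \<alpha> (z + t) \<partial>lborel)))
        \<le> eLp q \<beta> + eLp q (\<lambda>z. E a * \<alpha> z + (\<integral>\<^sup>+t. ?k t * \<alpha> (z + t) \<partial>lborel))"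
      using q by (intro eLp_add) auto
    also have "eLp q (\<lambda>z. E a * \<alpha> z + (\<integral>\<^sup>+t. ?k t * \<alpha> (z + t) \<partial>lborel))
        \<le> eLp q (\<lambda>z. E a * \<alpha> z) + eLp q (\<lambda>z. \<integral>\<^sup>+t. ?k t * \<alpha> (z + t) \<partial>lborel)"
      using q by (intro eLp_add) auto
    also have "eLp q (\<lambda>z. E a * \<alpha> z) \<le> E a * eLp q \<alpha>"
      using q E by (intro eLp_cmult) auto
    also have "eLp q (\<lambda>z. \<integral>\<^sup>+t. ?k t * \<alpha> (z + t) \<partial>lborel) \<le> E a * eLp q \<alpha>"
      using q E unfolding E_def by (intro eLp_convolution) auto
    also have "C * (eLp q \<beta> + (E a * eLp q \<alpha> + E a * eLp q \<alpha>)) = C * eLp q \<beta> + (2 * C * E a) * eLp q \<alpha>"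
      by (simp add: algebra_simps flip: mult_2)
    finally have "eLp q \<alpha> \<le> C * eLp q \<beta> + (2 * C * E a) * eLp q \<alpha>"
      by (simp add: mult_left_mono add_left_mono add_mono)
    then have \<alpha>\<beta>: "eLp q \<alpha> \<le> 2 * (C * eLp q \<beta>)"
      using small \<alpha>fin by (rule ennreal_absorb)
    have \<beta>g: "eLp q \<beta> \<le> C1 * eLp q (enorm g)"
      unfolding \<beta>_def by (rule local_T) simp
    \<comment> \<open>Reading \<open>Sv\<close> as \<open>v = T g - T v\<close> leaves terms
      controlled by \<open>g\<close>, the second one through \<open>\<alpha>\<close>.\<close>
    have "eLp q (enorm v) \<le> eLp q (\<lambda>x. enorm (T g) x + enorm (T v) x)"
    proof (intro eLp_mono_AE)
      show "AE x in lborel. enorm v x \<le> enorm (T g) x + enorm (T v) x"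
        using Sv
      proof eventually_elim
        case (elim x)
        then have "v x = T g x - T v x" by (simp add: algebra_simps)
        then have "norm (v x) \<le> norm (T g x) + norm (T v x)" by (simp add: norm_triangle_ineq4)
        then have "ennreal (norm (v x)) \<le> ennreal (norm (T g x) + norm (T v x))" by (rule ennreal_leI)
        then show ?case by simp
      qed
    qed measurable
    also have "\<dots> \<le> eLp q (enorm (T g)) + eLp q (enorm (T v))"
      using q by (intro eLp_add) auto
    also have "eLp q (enorm (T g)) \<le> ?H * eLp q (enorm g)"
      using q by (intro eLp_T_le) auto
    also have "eLp q (enorm (T v)) \<le> eLp q (hconv (enorm v))"
      by (intro eLp_mono T_le) auto
    also have "\<dots> \<le> C2 * eLp q \<alpha>"
      unfolding \<alpha>_def by (intro C2) auto
    also have "\<dots> \<le> C2 * (2 * (C * (C1 * eLp q (enorm g))))"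
      by (intro mult_left_mono order_trans[OF \<alpha>\<beta>] \<beta>g) auto
    finally have v_le: "eLp q (enorm v) \<le> ?H * eLp q (enorm g) + C2 * (2 * (C * (C1 * eLp q (enorm g))))"
      by (simp add: add_mono)
    have "eLp q (enorm f) \<le> eLp q (\<lambda>x. enorm g x + enorm v x)"
    proof (intro eLp_mono)
      fix x
      have "norm (f x) \<le> norm (g x) + norm (v x)"
        using norm_triangle_ineq4[of "g x" "v x"] by (simp add: g_def v_def)
      then have "ennreal (norm (f x)) \<le> ennreal (norm (g x) + norm (v x))" by (rule ennreal_leI)
      then show "enorm f x \<le> enorm g x + enorm v x" by simp
    qed measurable
    also have "\<dots> \<le> eLp q (enorm g) + eLp q (enorm v)"
      using q by (intro eLp_add) auto
    also have "\<dots> \<le> eLp q (enorm g) + (?H * eLp q (enorm g) + C2 * (2 * (C * (C1 * eLp q (enorm g)))))"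
      by (intro add_left_mono v_le)
    also have "\<dots> = (1 + (?H + C2 * (2 * (C * C1)))) * eLp q (enorm g)"
      by (simp add: algebra_simps)
    finally show "eLp q (enorm f) \<le> (1 + (?H + C2 * (2 * (C * C1)))) * eLp q (enorm (\<lambda>x. f x + T f x))"
      by (simp add: g_def[abs_def])
  qed
qed

end

section \<open>Comparison of \<open>eLp\<close> with \<open>Lp_space\<close> and
  \<open>Lp_norm\<close>\<close>

lemma eLp_infinity_iff:
  fixes f :: "'a::euclidean_space \<Rightarrow> complex"
  assumes "0 \<le> c" and [measurable]: "f \<in> borel_measurable borel"
  shows "eLp \<infinity> (enorm f) \<le> ennreal c \<longleftrightarrow> (AE x in lborel. norm (f x) \<le> c)"
proof -
  have "esssup lborel (enorm f) \<le> ennreal c \<longleftrightarrow> (AE x in lborel. enorm f x \<le> ennreal c)"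
    using esssup_AE[where M=lborel and f="enorm f"] esssup_I[of "enorm f" lborel "ennreal c"]
    by (auto elim: eventually_mono order_trans)
  then show ?thesis using assms by (simp add: eLp_def)
qed

lemma esssup_norm_iff:
  fixes f :: "'a::euclidean_space \<Rightarrow> complex"
  assumes [measurable]: "f \<in> borel_measurable borel"
  shows "esssup lborel (\<lambda>x. ereal (norm (f x))) \<le> ereal c \<longleftrightarrow> (AE x in lborel. norm (f x) \<le> c)"
proof
  assume le: "esssup lborel (\<lambda>x. ereal (norm (f x))) \<le> ereal c"
  show "AE x in lborel. norm (f x) \<le> c"
    using esssup_AE[of "\<lambda>x. ereal (norm (f x))" lborel]
    by (rule eventually_mono) (metis ereal_less_eq(3) le order_trans)
qed (intro esssup_I, auto)

text \<open>For finite \<open>p\<close> the Bochner integral in \<open>Lp_norm\<close> agrees with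
  the extended one. For \<open>p = \<infinity>\<close> the essential suprema in \<open>ereal\<close>
  and \<open>ennreal\<close> are compared through their upper bounds, which are the same
  almost-everywhere statements.\<close>

lemma Lp_space_iff_eLp:
  fixes f :: "real^'d \<Rightarrow> complex"
  assumes "1 \<le> p"
  shows "f \<in> Lp_space p \<longleftrightarrow> f \<in> borel_measurable borel \<and> eLp p (enorm f) < \<infinity>" (is ?A)
    and "f \<in> Lp_space p \<Longrightarrow> eLp p (enorm f) = ennreal (Lp_norm p f)" (is "_ \<Longrightarrow> ?B")
    and "f \<in> Lp_space p \<Longrightarrow> 0 \<le> Lp_norm p f" (is "_ \<Longrightarrow> ?C")
proof -
  have "?A \<and> (f \<in> Lp_space p \<longrightarrow> ?B) \<and> ?C" if m[measurable]: "f \<in> borel_measurable borel"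
    using assms
  proof (cases rule: ge1_cases)
    case 1
    let ?e = "esssup lborel (\<lambda>x. ereal (norm (f x)))" and ?E = "eLp \<infinity> (enorm f)"
    \<comment> \<open>This rests on Lebesgue measure not being null: a negative bound on the norm
      could hold almost everywhere only on a null space.\<close>
    have "0 \<le> ?e"
    proof (rule ccontr)
      assume "\<not> 0 \<le> ?e"
      then obtain c where "?e \<le> ereal c" "c < 0"
        by (metis ereal_dense2 less_ereal.simps(1) less_imp_le not_le zero_ereal_def)
      then have "AE x in lborel. norm (f x) \<le> c" by (simp add: esssup_norm_iff)
      then have "AE x::real^'d in lborel. False"
        by (rule eventually_mono) (use \<open>c < 0\<close> norm_ge_zero in \<open>meson not_le order_trans\<close>)
      then show False using emeasure_lborel_UNIV by (simp add: ae_filter_eq_bot_iff)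
    qed
    have iff: "?e \<le> ereal c \<longleftrightarrow> ?E \<le> ennreal c" if "0 \<le> c" for c
      unfolding eLp_infinity_iff[OF that m] esssup_norm_iff[OF m] ..
    have eq: "?E = ennreal e" if "?e = ereal e" for e
    proof (rule antisym)
      have "0 \<le> e" using that \<open>0 \<le> ?e\<close> by simp
      then show "?E \<le> ennreal e" using iff[of e] that by simp
      then obtain r where r: "?E = ennreal r" "0 \<le> r" by (cases ?E) (auto simp: top_unique)
      then show "ennreal e \<le> ?E" using iff[of r] that by (simp add: ennreal_leI)
    qed
    have fin: "?e < \<infinity>" if "?E < \<infinity>"
    proof -
      obtain r where "?E = ennreal r" "0 \<le> r" using \<open>?E < \<infinity>\<close> by (cases ?E) auto
      then have "?e \<le> ereal r" using iff[of r] by simp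
      then show ?thesis by (rule le_less_trans) simp
    qed
    show ?thesis
      using fin eq \<open>0 \<le> ?e\<close> by (cases ?e) (auto simp: 1 Lp_space_def Lp_norm_def)
  next
    case (2 r)
    let ?I = "\<integral>\<^sup>+x. ennreal (norm (f x) powr r) \<partial>lborel"
    have E: "eLp p (enorm f) = young (1 / p) ?I"
      using 2 by (simp add: eLp_def young_def)
    have inv: "1 / p = ennreal (1 / r)"
      using 2 by (simp add: divide_ennreal flip: ennreal_1)
    have iff: "f \<in> Lp_space p \<longleftrightarrow> ?I < \<infinity>"
      using 2 by (simp add: Lp_space_def integrable_iff_bounded)
    have norm: "Lp_norm p f = (LINT x|lborel. norm (f x) powr r) powr (1 / r)"
      using 2 by (simp add: Lp_norm_def)
    have "eLp p (enorm f) = ennreal (Lp_norm p f)" if "f \<in> Lp_space p"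
    proof -
      have "?I = ennreal (LINT x|lborel. norm (f x) powr r)"
        using that 2 by (intro nn_integral_eq_integral) (auto simp: Lp_space_def)
      then show ?thesis
        unfolding E inv norm using 2 by (simp add: young_def integral_nonneg_AE)
    qed
    moreover have "eLp p (enorm f) < \<infinity> \<longleftrightarrow> ?I < \<infinity>"
      unfolding E inv by (auto simp: young_def less_top[symmetric])
    ultimately show ?thesis using iff norm by simp
  qed
  moreover have "f \<in> borel_measurable borel" if "f \<in> Lp_space p" using that by (simp add: Lp_space_def)
  ultimately show ?A "f \<in> Lp_space p \<Longrightarrow> ?B" "f \<in> Lp_space p \<Longrightarrow> ?C" by blast+
qed

theorem theorem4p1:
  fixes \<alpha> D :: real
    and K :: "real^'d \<Rightarrow> real^'d \<Rightarrow> complex"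
    and p :: ennreal
  assumes "0 < \<alpha>" and "\<alpha> \<le> 1" and "0 < D"
    and "wiener_norm (\<lambda>x. SUP y. ennreal (norm (K y (x + y)))) \<le> ennreal D"
    and "\<And>\<delta>. 0 < \<delta> \<Longrightarrow> \<delta> < 1 \<Longrightarrow>
           wiener_norm (\<lambda>x. SUP y. modulus_of_continuity \<delta> K y (x + y)) \<le> ennreal (D * \<delta> powr \<alpha>)"
    and "1 \<le> p"
    and "Lp_stable p (\<lambda>f x. f x + integral_operator K f x)"
  shows "\<forall>q\<ge>1. Lp_stable q (\<lambda>f x. f x + integral_operator K f x)"
proof (intro allI impI)
  fix q :: ennreal assume q: "1 \<le> q"
  have p: "1 \<le> p" by fact
  have "wiener_norm (\<lambda>x. SUP y. ennreal (norm (K y (x + y)))) < \<infinity>"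
    using assms(4) by (rule le_less_trans) simp
  from wiener_norm_majorant[OF this] obtain h :: "real^'d \<Rightarrow> ennreal" where h: "h \<in> borel_measurable borel" "(\<integral>\<^sup>+t. h t \<partial>lborel) < \<infinity>"
    "\<And>t. (SUP y. ennreal (norm (K y (t + y)))) \<le> h t" "\<And>t s. h (t + s) \<le> ennreal (exp (l1 s)) * h t"
    by blast
  have "continuous_on UNIV (\<lambda>(x, y). K x y)"
    using assms(1,3,5) by (rule kernel_continuous)
  then have "(\<lambda>(x, y). K x y) \<in> borel_measurable (borel \<Otimes>\<^sub>M borel)"
    by (simp add: borel_prod borel_measurable_continuous_onI)
  moreover have "ennreal (norm (K x (x + t))) \<le> h t" for x t
    using h(3)[of t] by (auto simp: SUP_le_iff add.commute)
  ultimately interpret dominated_kernel K h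
    using h by unfold_locales auto
  let ?S = "\<lambda>f x. f x + T f x"
  let ?H = "\<integral>\<^sup>+t. h t \<partial>lborel"
  \<comment> \<open>Boundedness holds for every exponent by the convolution bound; the stability
    hypothesis enters in the lower bound.\<close>
  have upper: "eLp r (enorm (?S f)) \<le> (1 + ?H) * eLp r (enorm f)"
    if r: "1 \<le> r" and [measurable]: "f \<in> borel_measurable borel" for r f
  proof -
    have "eLp r (enorm (?S f)) \<le> eLp r (\<lambda>x. enorm f x + enorm (T f) x)"
    proof (intro eLp_mono)
      fix x
      have "ennreal (norm (f x + T f x)) \<le> ennreal (norm (f x) + norm (T f x))"
        by (intro ennreal_leI norm_triangle_ineq)
      then show "enorm (?S f) x \<le> enorm f x + enorm (T f) x" by simp
    qed measurable
    also have "\<dots> \<le> eLp r (enorm f) + eLp r (enorm (T f))"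
      using r by (intro eLp_add) auto
    also have "\<dots> \<le> eLp r (enorm f) + ?H * eLp r (enorm f)"
      using r by (intro add_left_mono eLp_T_le) auto
    finally show ?thesis by (simp add: distrib_right)
  qed
  have S_Lp: "?S f \<in> Lp_space r" if r: "1 \<le> r" and f: "f \<in> Lp_space r" for r f
    using f upper[OF r, of f] h_finite unfolding Lp_space_iff_eLp[OF r]
    by (auto simp: ennreal_mult_less_top intro: le_less_trans)
  obtain C where C: "0 < C" "\<And>f. f \<in> Lp_space p \<Longrightarrow> inverse C * Lp_norm p f \<le> Lp_norm p (?S f)"
    using assms(7) unfolding Lp_stable_def by blast
  \<comment> \<open>Finiteness of \<open>eLp\<close> places \<open>f\<close> in
    \<open>Lp_space p\<close>, where real and extended norms agree.\<close>
  have stab: "eLp p (enorm f) \<le> ennreal C * eLp p (enorm (?S f))"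
    if "f \<in> borel_measurable borel" "eLp p (enorm f) < \<infinity>" for f
  proof -
    have f: "f \<in> Lp_space p" using that by (simp add: Lp_space_iff_eLp[OF p])
    have "Lp_norm p f \<le> C * Lp_norm p (?S f)"
      using C(2)[OF f] C(1) by (simp add: field_simps)
    then have "ennreal (Lp_norm p f) \<le> ennreal C * ennreal (Lp_norm p (?S f))"
      using C(1) Lp_space_iff_eLp(3)[OF p S_Lp[OF p f]] by (simp add: ennreal_leI flip: ennreal_mult)
    then show ?thesis using f S_Lp[OF p f] by (simp add: Lp_space_iff_eLp(2)[OF p])
  qed
  have "ennreal C < \<infinity>" by simp
  from eLp_stable_transfer[OF p q this stab] obtain C' where C': "C' < \<infinity>"
    "\<And>f. f \<in> borel_measurable borel \<Longrightarrow> eLp q (enorm f) < \<infinity> \<Longrightarrow>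
      eLp q (enorm f) \<le> C' * eLp q (enorm (?S f))"
    by blast
  define B where "B = enn2real (1 + ?H)"
  define A where "A = enn2real C'"
  have B: "1 + ?H = ennreal B" and A: "C' = ennreal A"
    using h_finite C' by (auto simp: A_def B_def)
  have nonneg: "0 \<le> A" "0 \<le> B" by (auto simp: A_def B_def)
  have up: "Lp_norm q (?S f) \<le> B * Lp_norm q f" and low: "Lp_norm q f \<le> A * Lp_norm q (?S f)"
    if f: "f \<in> Lp_space q" for f
    using upper[OF q, of f] C'(2)[of f] f S_Lp[OF q f] Lp_space_iff_eLp(3)[OF q f]
      Lp_space_iff_eLp(3)[OF q S_Lp[OF q f]] nonneg
    by (auto simp: A B Lp_space_iff_eLp(2)[OF q] Lp_space_iff_eLp(1)[OF q, of f] simp flip: ennreal_mult)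
  have intg: "AE x in lborel. integrable lborel (\<lambda>y. K x y * f y)" if "f \<in> Lp_space q" for f
    using that by (intro AE_integrable[OF q]) (auto simp: Lp_space_iff_eLp[OF q])
  have meas: "f \<in> borel_measurable borel" if "f \<in> Lp_space q" for f
    using that by (simp add: Lp_space_iff_eLp[OF q])
  have "Lp_bounded_operator q ?S"
    unfolding Lp_bounded_operator_def
  proof (intro conjI ballI impI allI)
    fix f g :: "real^'d \<Rightarrow> complex"
    assume f: "f \<in> Lp_space q" and g: "g \<in> Lp_space q"
    \<comment> \<open>Where integrals diverge \<open>T\<close> takes the default value
      \<open>0\<close> and additivity may fail; such points form a null set.\<close>
    show "AE x in lborel. (f x + g x) + T (\<lambda>t. f t + g t) x = (f x + T f x) + (g x + T g x)"
      using intg[OF f] intg[OF g] by eventually_elim (simp add: T_add)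
    assume "AE x in lborel. f x = g x"
    then show "AE x in lborel. f x + T f x = g x + T g x"
      using T_cong_AE[OF meas[OF f] meas[OF g]] by (auto elim: eventually_mono)
  next
    show "\<exists>B. \<forall>f\<in>Lp_space q. Lp_norm q (?S f) \<le> B * Lp_norm q f"
      using up by blast
  qed (use S_Lp[OF q] in \<open>auto simp: T_cmult distrib_left\<close>)
  moreover have "\<exists>C>0. \<forall>f\<in>Lp_space q. inverse C * Lp_norm q f \<le> Lp_norm q (?S f) \<and> Lp_norm q (?S f) \<le> C * Lp_norm q f"
  \<comment> \<open>One constant serves both bounds; the \<open>1\<close> keeps it positive.\<close>
  proof (intro exI[of _ "A + B + 1"] conjI ballI)
    fix f :: "real^'d \<Rightarrow> complex" assume f: "f \<in> Lp_space q"
    have "Lp_norm q f \<le> (A + B + 1) * Lp_norm q (?S f)"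
      using low[OF f] Lp_space_iff_eLp(3)[OF q S_Lp[OF q f]] nonneg
      by (elim order_trans) (intro mult_right_mono, auto)
    then show "inverse (A + B + 1) * Lp_norm q f \<le> Lp_norm q (?S f)"
      using nonneg by (simp add: field_simps add_pos_nonneg)
    show "Lp_norm q (?S f) \<le> (A + B + 1) * Lp_norm q f"
      using up[OF f] Lp_space_iff_eLp(3)[OF q f] nonneg
      by (elim order_trans) (intro mult_right_mono, auto)
  qed (use nonneg in auto)
  ultimately show "Lp_stable q ?S" by (simp add: Lp_stable_def)
qed

end
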